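(* Let $B$ be a nucleation process and $G$ a growth process on $[t_0,T]$, and let $\Theta=\{\Theta_t:t\in[t_0,T]\}$ be the associated geometric random process. Then $\Theta$ is non-decreasing with respect to set inclusion, i.e. $$\mathbb P\big(\Theta_s\subseteq\Theta_t\ \ \forall\, t_0\le s<t\le T\big)=1.$$ Moreover, $\Theta$ is adapted to the filtration $\{\mathfrak F_t\}_{t\in[t_0,T]}$, i.e. $\Theta_t$ is $\mathfrak F_t$-measurable for every $t\in[t_0,T]$.
   Context: Setting. $\mathfrak X$ is a reflexive Banach space with separable dual; $[t_0,T]\subset\mathbb R$; $(\Omega,\mathfrak F,\{\mathfrak F_t\}_{t\in[t_0,T]},\mathbb P)$ is a filtered complete probability space satisfying the usual conditions. $\mathbb F(\mathfrak X)$ is the family of non-empty closed subsets of $\mathfrak X$. A set-valued map $X$ defined on a measurable space $(E,\mathcal E)$ with values in subsets of $\mathfrak X$ is measurable if $\{e: X(e)\cap O\neq\emptyset\}\in\mathcal E$ for every open $O\subseteq\mathfrak X$. A random closed set is a measurable map $\Omega\to\mathbb F(\mathfrak X)$. The Hausdorff distance on $\mathbb F(\mathfrak X)$ (possibly $+\infty$) is $\delta_H(A,C)=\max\{\sup_{a\in A}\inf_{c\in C}\|a-c\|,\ \sup_{c\in C}\inf_{a\in A}\|a-c\|\}$. Nucleation process: a map $B:\Omega\times[t_0,T]\to\mathbb F(\mathfrak X)$, $B_t=B(\cdot,t)$, such that $B_t$ is $\mathfrak F_t$-measurable for every $t$, and $B_s\subseteq B_t$ whenever $s<t$. Growth process: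 a map $G:\Omega\times[t_0,T]\to\mathbb F(\mathfrak X)$ such that for all $(\omega,t)$: $0\in G(\omega,t)$, $G(\omega,t)$ is convex, $G(\omega,t)\subseteq K$ for a fixed non-empty closed bounded set $K\subset\mathfrak X$ (independent of $\omega,t$), and $G$ is measurable with respect to the predictable $\sigma$-algebra $\mathcal P$ on $\Omega\times[t_0,T]$, i.e. the $\sigma$-algebra generated by the sets $A\times\{t_0\}$ with $A\in\mathfrak F_{t_0}$ and $A\times(s,t]$ with $A\in\mathfrak F_s$, $(s,t]\subset[t_0,T]$. For $a\le b$, $\int_a^b G(\tau)\,d\tau$ is the random set $\omega\mapsto\int_a^bG(\omega,\tau)\,d\tau$, the Aumann integral with respect to Lebesgue measure: $\{\int_a^b g(\tau)\,d\tau: g \text{ Bochner integrable on }[t_0,T],\ g(\tau)\in G(\omega,\tau)\text{ for a.e. }\tau\}$. Minkowski sum: $A+C=\{a+c:a\in A,c\in C\}$ (with $\emptyset+A=\emptyset$), and $A\oplus C=\overline{A+C}$. A partition of $[t_0,t]$ is $\Pi=(t_i)_{i=0}^n$ with $t_0<t_1<\dots<t_n=t$ (for $t=t_0$ the only partition is $(t_0)$, $n=0$); its mesh is $|\Pi|=\max_i(t_i-t_{i-1})$. A refinement sequence of $[t_0,t]$ is a sequence of partitions $\{\Pi_j\}_{j\in\mathbb N}$ of $[t_0,t]$ with $|\Pi_j|\to0$ as $j\to\infty$. Put $\Delta B_{t_i}=B_{t_i}\setminus B_{t_{i-1}}^{o}$, where $B^{o}$ is the interior of $B$, and $$s_\Pi(t)=\Big(B_{t_0}\oplus\int_{t_0}^tG(\tau)d\tau\Big)\cup\bigcup_{i=1}^n\Big(\Delta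 B_{t_i}\oplus\int_{t_i}^tG(\tau)d\tau\Big),$$ $$S_\Pi(t)=\Big(B_{t_0}\oplus\int_{t_0}^tG(\tau)d\tau\Big)\cup\bigcup_{i=1}^n\Big(\Delta B_{t_i}\oplus\int_{t_{i-1}}^tG(\tau)d\tau\Big).$$ Geometric random process: for each $t\in[t_0,T]$, $\Theta_t$ is the random closed set $$\Theta_t=\overline{\bigcup_{j}s_{\Pi_j}(t)}=\overline{\lim_{j\to\infty}s_{\Pi_j}(t)}=\lim_{j\to\infty}S_{\Pi_j}(t)=\bigcap_jS_{\Pi_j}(t),$$ where $\{\Pi_j\}$ is any refinement sequence of $[t_0,t]$ and the limits are in $\delta_H$ (these limits exist, coincide, and do not depend on the choice of refinement sequence). *)

theory Defs
  imports "HOL-Probability.Probability" "HOL-Library.Set_Algebras"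
begin

section \<open>The Banach space\<close>

definition reflexive_banach :: "'a::banach itself \<Rightarrow> bool" where
  "reflexive_banach _ \<longleftrightarrow>
     (\<forall>\<Phi> :: ('a \<Rightarrow>\<^sub>L real) \<Rightarrow>\<^sub>L real. \<exists>x::'a. \<forall>f :: 'a \<Rightarrow>\<^sub>L real.
        blinfun_apply \<Phi> f = blinfun_apply f x)"

definition separable_dual :: "'a::banach itself \<Rightarrow> bool" where
  "separable_dual _ \<longleftrightarrow> separable_space (euclidean :: ('a \<Rightarrow>\<^sub>L real) topology)"

section \<open>The filtered probability space\<close>

text \<open>The filtration is indexed by \<open>{t0..T}\<close>; the values of \<open>F\<close> outside this interval are irrelevant.\<close>

locale filtered_complete_prob_space = prob_space M + complete_measure M
  for M :: "'w measure" +
  fixes F :: "real \<Rightarrow> 'w measure" and t0 T :: real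
  assumes interval: "t0 \<le> T"
    and subalgebra_F: "t \<in> {t0..T} \<Longrightarrow> subalgebra M (F t)"
    and sets_F_mono: "s \<in> {t0..T} \<Longrightarrow> t \<in> {t0..T} \<Longrightarrow> s \<le> t \<Longrightarrow> sets (F s) \<subseteq> sets (F t)"
    and null_sets_F: "null_sets M \<subseteq> sets (F t0)"
    and right_continuous_F: "t \<in> {t0..<T} \<Longrightarrow> sets (F t) = (\<Inter>s\<in>{t<..T}. sets (F s))"

definition predictable_sigma ::
    "'w measure \<Rightarrow> (real \<Rightarrow> 'w measure) \<Rightarrow> real \<Rightarrow> real \<Rightarrow> ('w \<times> real) measure" where
  "predictable_sigma M F t0 T = sigma (space M \<times> {t0..T})
     ({A \<times> {t0} | A. A \<in> sets (F t0)} \<union>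
      {A \<times> {s<..t} | A s t. t0 \<le> s \<and> s < t \<and> t \<le> T \<and> A \<in> sets (F s)})"

section \<open>Random closed sets, nucleation and growth\<close>

definition measurable_set_map :: "'e measure \<Rightarrow> ('e \<Rightarrow> 'a::topological_space set) \<Rightarrow> bool" where
  "measurable_set_map N X \<longleftrightarrow> (\<forall>U. open U \<longrightarrow> {e \<in> space N. X e \<inter> U \<noteq> {}} \<in> sets N)"

definition random_closed_set :: "'e measure \<Rightarrow> ('e \<Rightarrow> 'a::topological_space set) \<Rightarrow> bool" where
  "random_closed_set N X \<longleftrightarrow>
     (\<forall>e\<in>space N. X e \<noteq> {} \<and> closed (X e)) \<and> measurable_set_map N X"

definition nucleation_process ::
    "'w measure \<Rightarrow> (real \<Rightarrow> 'w measure) \<Rightarrow> real \<Rightarrow> real \<Rightarrow> ('w \<Rightarrow> real \<Rightarrow> 'a::banach set) \<Rightarrow> bool" where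
  "nucleation_process M F t0 T B \<longleftrightarrow>
     (\<forall>t\<in>{t0..T}. random_closed_set (F t) (\<lambda>\<omega>. B \<omega> t)) \<and>
     (\<forall>\<omega>\<in>space M. \<forall>s\<in>{t0..T}. \<forall>t\<in>{t0..T}. s < t \<longrightarrow> B \<omega> s \<subseteq> B \<omega> t)"

definition growth_process ::
    "'w measure \<Rightarrow> (real \<Rightarrow> 'w measure) \<Rightarrow> real \<Rightarrow> real \<Rightarrow> ('w \<Rightarrow> real \<Rightarrow> 'a::banach set) \<Rightarrow> bool" where
  "growth_process M F t0 T G \<longleftrightarrow>
     (\<forall>\<omega>\<in>space M. \<forall>t\<in>{t0..T}. closed (G \<omega> t) \<and> 0 \<in> G \<omega> t \<and> convex (G \<omega> t)) \<and>
     (\<exists>K. K \<noteq> {} \<and> closed K \<and> bounded K \<and> (\<forall>\<omega>\<in>space M. \<forall>t\<in>{t0..T}. G \<omega> t \<subseteq> K)) \<and>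
     measurable_set_map (predictable_sigma M F t0 T) (\<lambda>(\<omega>, t). G \<omega> t)"

section \<open>Geometric random process\<close>

text \<open>The Bochner integral of the library needs the class \<open>second_countable_topology\<close>. A Banach
  space with separable dual is separable, so this class constraint excludes no such space.\<close>

definition aumann_integral ::
    "real \<Rightarrow> real \<Rightarrow> (real \<Rightarrow> 'a::{banach, second_countable_topology} set) \<Rightarrow> real \<Rightarrow> real \<Rightarrow> 'a set" where
  "aumann_integral t0 T H a b =
     {integral\<^sup>L (lebesgue_on {a..b}) g | g.
        integrable (lebesgue_on {t0..T}) g \<and> (AE \<tau> in lebesgue_on {t0..T}. g \<tau> \<in> H \<tau>)}"

text \<open>In \<open>ennreal\<close> infima over \<open>{}\<close> are \<open>\<infinity>\<close> and suprema over \<open>{}\<close> are \<open>0\<close>.\<close>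

definition hausdorff_distance :: "'a::real_normed_vector set \<Rightarrow> 'a set \<Rightarrow> ennreal" where
  "hausdorff_distance A C =
     max (SUP a\<in>A. INF c\<in>C. ennreal (norm (a - c))) (SUP c\<in>C. INF a\<in>A. ennreal (norm (a - c)))"

definition closed_minkowski_sum :: "'a::real_normed_vector set \<Rightarrow> 'a set \<Rightarrow> 'a set" where
  "closed_minkowski_sum A C = closure (A + C)"

text \<open>A partition \<open>t0 = p\<^sub>0 < ... < p\<^sub>n = t\<close> is the strictly increasing list of its \<open>n + 1\<close> points.\<close>

definition is_partition :: "real \<Rightarrow> real \<Rightarrow> real list \<Rightarrow> bool" where
  "is_partition t0 t p \<longleftrightarrow> p \<noteq> [] \<and> hd p = t0 \<and> last p = t \<and> sorted_wrt (<) p"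

definition mesh :: "real list \<Rightarrow> real" where
  "mesh p = Max (insert 0 ((\<lambda>i. p ! i - p ! (i - 1)) ` {1..<length p}))"

definition refinement_sequence :: "real \<Rightarrow> real \<Rightarrow> (nat \<Rightarrow> real list) \<Rightarrow> bool" where
  "refinement_sequence t0 t P \<longleftrightarrow>
     (\<forall>j. is_partition t0 t (P j)) \<and> (\<lambda>j. mesh (P j)) \<longlonglongrightarrow> 0"

text \<open>In the next four definitions \<open>B\<close> and \<open>G\<close> are the set-valued functions of time obtained
  by fixing \<open>\<omega>\<close>.\<close>

definition increment :: "(real \<Rightarrow> 'a::topological_space set) \<Rightarrow> real list \<Rightarrow> nat \<Rightarrow> 'a set" where
  "increment B p i = B (p ! i) - interior (B (p ! (i - 1)))"

definition lower_sum ::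
    "real \<Rightarrow> real \<Rightarrow> (real \<Rightarrow> 'a::{banach, second_countable_topology} set) \<Rightarrow> (real \<Rightarrow> 'a set) \<Rightarrow>
     real \<Rightarrow> real list \<Rightarrow> 'a set" where
  "lower_sum t0 T B G t p =
     closed_minkowski_sum (B t0) (aumann_integral t0 T G t0 t) \<union>
     (\<Union>i\<in>{1..<length p}.
        closed_minkowski_sum (increment B p i) (aumann_integral t0 T G (p ! i) t))"

definition upper_sum ::
    "real \<Rightarrow> real \<Rightarrow> (real \<Rightarrow> 'a::{banach, second_countable_topology} set) \<Rightarrow> (real \<Rightarrow> 'a set) \<Rightarrow>
     real \<Rightarrow> real list \<Rightarrow> 'a set" where
  "upper_sum t0 T B G t p =
     closed_minkowski_sum (B t0) (aumann_integral t0 T G t0 t) \<union>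
     (\<Union>i\<in>{1..<length p}.
        closed_minkowski_sum (increment B p i) (aumann_integral t0 T G (p ! (i - 1)) t))"

text \<open>\<open>C\<close> is closed by the first equation, so the two limits below are limits in the space of
  closed sets, where limits are unique, and the closure of a limit is the limit itself.\<close>

definition geometric_value ::
    "real \<Rightarrow> real \<Rightarrow> (real \<Rightarrow> 'a::{banach, second_countable_topology} set) \<Rightarrow> (real \<Rightarrow> 'a set) \<Rightarrow>
     real \<Rightarrow> 'a set \<Rightarrow> bool" where
  "geometric_value t0 T B G t C \<longleftrightarrow>
     (\<forall>P. refinement_sequence t0 t P \<longrightarrow>
        C = closure (\<Union>j. lower_sum t0 T B G t (P j)) \<and>
        (\<lambda>j. hausdorff_distance (lower_sum t0 T B G t (P j)) C) \<longlonglongrightarrow> 0 \<and>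
        (\<lambda>j. hausdorff_distance (upper_sum t0 T B G t (P j)) C) \<longlonglongrightarrow> 0 \<and>
        C = (\<Inter>j. upper_sum t0 T B G t (P j)))"

definition geometric_random_process ::
    "'w measure \<Rightarrow> real \<Rightarrow> real \<Rightarrow> ('w \<Rightarrow> real \<Rightarrow> 'a::{banach, second_countable_topology} set) \<Rightarrow>
     ('w \<Rightarrow> real \<Rightarrow> 'a set) \<Rightarrow> ('w \<Rightarrow> real \<Rightarrow> 'a set) \<Rightarrow> bool" where
  "geometric_random_process M t0 T B G \<Theta> \<longleftrightarrow>
     (\<forall>\<omega>\<in>space M. \<forall>t\<in>{t0..T}. geometric_value t0 T (B \<omega>) (G \<omega>) t (\<Theta> \<omega> t))"

section \<open>Existence and uniqueness of the geometric random process\<close>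

lemma is_partitionD:
  assumes "is_partition t0 t p"
  shows "0 < length p" "p ! 0 = t0" "p ! (length p - 1) = t"
    "\<And>i j. i < j \<Longrightarrow> j < length p \<Longrightarrow> p ! i < p ! j"
    "\<And>i. i < length p \<Longrightarrow> t0 \<le> p ! i" "\<And>i. i < length p \<Longrightarrow> p ! i \<le> t"
proof -
  show 1: "0 < length p" "p ! 0 = t0" "p ! (length p - 1) = t"
    using assms by (auto simp: is_partition_def hd_conv_nth last_conv_nth)
  show 2: "\<And>i j. i < j \<Longrightarrow> j < length p \<Longrightarrow> p ! i < p ! j"
    using assms by (auto simp: is_partition_def sorted_wrt_iff_nth_less)
  show "t0 \<le> p ! i" if "i < length p" for i
    using 1(2) 2[of 0 i] that by (cases i) auto
  show "p ! i \<le> t" if "i < length p" for i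
  proof (cases "i = length p - 1")
    case False
    with that have "i < length p - 1" by simp
    then have "p ! i < p ! (length p - 1)" by (rule 2) (use 1 in simp)
    then show ?thesis using 1 by simp
  qed (use 1 in simp)
qed

lemma mesh_ge: "1 \<le> i \<Longrightarrow> i < length p \<Longrightarrow> p ! i - p ! (i - 1) \<le> mesh p"
  unfolding mesh_def by (rule Max_ge) auto

lemma mesh_nonneg: "0 \<le> mesh p"
  unfolding mesh_def by (rule Max_ge) auto

lemma refinement_sequence_exists:
  assumes "t0 \<le> t" shows "\<exists>P. refinement_sequence t0 t P"
proof (cases "t0 = t")
  case True
  then have "refinement_sequence t0 t (\<lambda>j. [t0])"
    by (auto simp: refinement_sequence_def is_partition_def mesh_def)
  then show ?thesis by (rule exI[where P = "refinement_sequence t0 t"])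
next
  case False
  with assms have lt: "t0 < t" by simp
  define P where "P j = map (\<lambda>i. t0 + (t - t0) * real i / real (Suc j)) [0..<j + 2]" for j :: nat
  have len: "length (P j) = j + 2" for j by (simp add: P_def)
  have nth: "P j ! i = t0 + (t - t0) * real i / real (Suc j)" if "i < j + 2" for i j
    unfolding P_def using that by (subst nth_map) (auto simp del: upt_Suc)
  have part: "is_partition t0 t (P j)" for j
    unfolding is_partition_def
  proof (intro conjI)
    show ne: "P j \<noteq> []" using len[of j] by auto
    show "hd (P j) = t0" using ne by (simp add: hd_conv_nth nth)
    show "last (P j) = t" using ne by (simp add: last_conv_nth len nth)
    show "sorted_wrt (<) (P j)"
      using lt by (auto simp: sorted_wrt_iff_nth_less len nth divide_strict_right_mono)
  qed
  have diff: "P j ! i - P j ! (i - 1) = (t - t0) / real (Suc j)" if "1 \<le> i" "i < j + 2" for i j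
  proof -
    have "P j ! i - P j ! (i - 1) = ((t - t0) * real i - (t - t0) * real (i - 1)) / real (Suc j)"
      using that by (simp add: nth diff_divide_distrib)
    also have "(t - t0) * real i - (t - t0) * real (i - 1) = t - t0"
      using that by (simp add: of_nat_diff algebra_simps)
    finally show ?thesis .
  qed
  have mesh: "mesh (P j) \<le> (t - t0) / real (Suc j)" for j
    unfolding mesh_def using lt by (subst Max_le_iff) (auto simp: len diff simp del: One_nat_def)
  have "(\<lambda>j. (t - t0) / real (Suc j)) \<longlonglongrightarrow> 0"
    by (rule LIMSEQ_Suc) (rule lim_const_over_n)
  then have "(\<lambda>j. mesh (P j)) \<longlonglongrightarrow> 0"
    by (rule Lim_null_comparison[rotated]) (use mesh mesh_nonneg in auto)
  with part show ?thesis unfolding refinement_sequence_def by blast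
qed

lemma geometric_value_unique:
  assumes "t0 \<le> t" "geometric_value t0 T B G t C" "geometric_value t0 T B G t D"
  shows "C = D"
  using refinement_sequence_exists[OF assms(1)] assms(2,3) unfolding geometric_value_def by blast

lemma aumann_integral_zero:
  assumes "\<And>\<tau>. \<tau> \<in> {t0..T} \<Longrightarrow> 0 \<in> H \<tau>"
  shows "0 \<in> aumann_integral t0 T H a b"
  unfolding aumann_integral_def
  by (rule CollectI, rule exI[of _ "\<lambda>_. 0"]) (auto intro!: AE_I2 assms simp: space_restrict_space)

lemma aumann_integral_antimono:
  assumes H: "\<And>\<tau>. \<tau> \<in> {t0..T} \<Longrightarrow> 0 \<in> H \<tau>" and "t0 \<le> a" "a \<le> b" "b \<le> t" "t \<le> T"
  shows "aumann_integral t0 T H b t \<subseteq> aumann_integral t0 T H a t"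
proof
  fix x assume "x \<in> aumann_integral t0 T H b t"
  then obtain g where g: "integrable (lebesgue_on {t0..T}) g"
      "AE \<tau> in lebesgue_on {t0..T}. g \<tau> \<in> H \<tau>" "x = integral\<^sup>L (lebesgue_on {b..t}) g"
    unfolding aumann_integral_def by auto
  define h where "h \<tau> = indicator {b..} \<tau> *\<^sub>R g \<tau>" for \<tau>
  have meas: "{b..} \<inter> {t0..T} \<in> sets (lebesgue_on {t0..T})"
    by (auto simp: sets_restrict_space intro!: image_eqI[where x="{b..}"])
  have "integrable (lebesgue_on {t0..T}) (\<lambda>\<tau>. indicator ({b..} \<inter> {t0..T}) \<tau> *\<^sub>R g \<tau>)"
    by (rule integrable_mult_indicator[OF meas g(1)])
  moreover have "integrable (lebesgue_on {t0..T}) h \<longleftrightarrow>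
      integrable (lebesgue_on {t0..T}) (\<lambda>\<tau>. indicator ({b..} \<inter> {t0..T}) \<tau> *\<^sub>R g \<tau>)"
    by (rule Bochner_Integration.integrable_cong) (auto simp: h_def indicator_def space_restrict_space)
  ultimately have 1: "integrable (lebesgue_on {t0..T}) h" by simp
  have 2: "AE \<tau> in lebesgue_on {t0..T}. h \<tau> \<in> H \<tau>"
    using g(2) AE_space
    by eventually_elim (auto simp: h_def indicator_def space_restrict_space intro: H)
  have "integral\<^sup>L (lebesgue_on {a..t}) h = integral\<^sup>L lebesgue (\<lambda>\<tau>. indicator {a..t} \<tau> *\<^sub>R h \<tau>)"
    by (rule integral_restrict_space) auto
  also have "\<dots> = integral\<^sup>L lebesgue (\<lambda>\<tau>. indicator {b..t} \<tau> *\<^sub>R g \<tau>)"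
    by (rule Bochner_Integration.integral_cong) (use assms in \<open>auto simp: h_def indicator_def\<close>)
  also have "\<dots> = integral\<^sup>L (lebesgue_on {b..t}) g"
    by (rule integral_restrict_space[symmetric]) auto
  finally show "x \<in> aumann_integral t0 T H a t"
    using 1 2 unfolding aumann_integral_def g(3) by (intro CollectI exI[of _ h] conjI) simp_all
qed

lemma aumann_integral_near:
  fixes H :: "real \<Rightarrow> 'a::{banach, second_countable_topology} set"
  assumes H: "\<And>\<tau> y. \<tau> \<in> {t0..T} \<Longrightarrow> y \<in> H \<tau> \<Longrightarrow> norm y \<le> R"
    and ab: "t0 \<le> a" "a \<le> b" "b \<le> t" "t \<le> T"
    and x: "x \<in> aumann_integral t0 T H a t"
  shows "\<exists>y\<in>aumann_integral t0 T H b t. norm (x - y) \<le> R * (b - a)"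
proof -
  obtain g where g: "integrable (lebesgue_on {t0..T}) g"
      "AE \<tau> in lebesgue_on {t0..T}. g \<tau> \<in> H \<tau>" "x = integral\<^sup>L (lebesgue_on {a..t}) g"
    using x unfolding aumann_integral_def by auto
  have g0: "integrable lebesgue (\<lambda>\<tau>. indicator {t0..T} \<tau> *\<^sub>R g \<tau>)"
    using g(1) by (subst (asm) integrable_restrict_space) auto
  have int: "set_integrable lebesgue S g" if "S \<subseteq> {t0..T}" "S \<in> sets lebesgue" for S
    using set_integrable_subset[of lebesgue "{t0..T}" g S] g0 that by (auto simp: set_integrable_def)
  have restr: "integral\<^sup>L (lebesgue_on S) g = set_lebesgue_integral lebesgue S g"
    if "S \<in> sets lebesgue" for S
    unfolding set_lebesgue_integral_def using that by (intro integral_restrict_space) auto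
  have "set_lebesgue_integral lebesgue ({a..<b} \<union> {b..t}) g =
      set_lebesgue_integral lebesgue {a..<b} g + set_lebesgue_integral lebesgue {b..t} g"
    by (rule set_integral_Un) (use ab in \<open>auto intro!: int\<close>)
  moreover have "{a..<b} \<union> {b..t} = {a..t}" using ab by auto
  ultimately have eq: "x - integral\<^sup>L (lebesgue_on {b..t}) g = set_lebesgue_integral lebesgue {a..<b} g"
    using g(3) by (simp add: restr)
  have R: "AE \<tau> in lebesgue. \<tau> \<in> {t0..T} \<longrightarrow> norm (g \<tau>) \<le> R"
    using g(2) by (subst (asm) AE_restrict_space_iff) (auto intro: H elim!: eventually_mono)
  have "norm (set_lebesgue_integral lebesgue {a..<b} g) \<le>
      (LINT \<tau>|lebesgue. norm (indicator {a..<b} \<tau> *\<^sub>R g \<tau>))"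
    unfolding set_lebesgue_integral_def by (rule integral_norm_bound)
  also have "\<dots> \<le> (LINT \<tau>|lebesgue. indicator {a..<b} \<tau> * R)"
  proof (rule integral_mono_AE)
    show "integrable lebesgue (\<lambda>\<tau>. norm (indicator {a..<b} \<tau> *\<^sub>R g \<tau>))"
      by (rule integrable_norm, rule int[unfolded set_integrable_def]) (use ab in auto)
    show "integrable lebesgue (\<lambda>\<tau>. indicator {a..<b} \<tau> * R)"
      using ab by (intro integrable_mult_left integrable_real_indicator) (auto simp: emeasure_lborel_Ico)
    show "AE \<tau> in lebesgue. norm (indicator {a..<b} \<tau> *\<^sub>R g \<tau>) \<le> indicator {a..<b} \<tau> * R"
      using R by eventually_elim (use ab in \<open>auto simp: indicator_def\<close>)
  qed
  also have "\<dots> = R * (b - a)" using ab by (simp add: measure_def)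
  finally show ?thesis
    using g eq unfolding aumann_integral_def by auto
qed

lemma set_closed_minkowski_sum_mono:
  "A \<subseteq> A' \<Longrightarrow> C \<subseteq> C' \<Longrightarrow> closed_minkowski_sum A C \<subseteq> closed_minkowski_sum A' C'"
  unfolding closed_minkowski_sum_def by (intro closure_mono set_plus_mono2)

lemma closed_minkowski_sum_near:
  assumes "x \<in> closed_minkowski_sum A C" "0 < e"
    and near: "\<And>c. c \<in> C \<Longrightarrow> \<exists>d\<in>D. norm (c - d) \<le> r"
  shows "\<exists>y\<in>closed_minkowski_sum A D. norm (x - y) \<le> r + e"
proof -
  obtain z where z: "z \<in> A + C" "dist z x < e"
    using assms(1,2) unfolding closed_minkowski_sum_def closure_approachable by blast
  then obtain a c where ac: "a \<in> A" "c \<in> C" "z = a + c" by (auto elim: set_plus_elim)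
  obtain d where d: "d \<in> D" "norm (c - d) \<le> r" using near[OF ac(2)] by blast
  have "a + d \<in> closed_minkowski_sum A D"
    unfolding closed_minkowski_sum_def by (rule subsetD[OF closure_subset]) (use ac d in auto)
  moreover have "norm (x - (a + d)) \<le> r + e"
  proof -
    have "x - (a + d) = (x - z) + (c - d)" by (simp add: ac)
    then have "norm (x - (a + d)) \<le> norm (x - z) + norm (c - d)" by (metis norm_triangle_ineq)
    then show ?thesis using z(2) d(2) by (simp add: dist_norm norm_minus_commute)
  qed
  ultimately show ?thesis by blast
qed

lemma closed_upper_sum: "closed (upper_sum t0 T B G t p)"
  unfolding upper_sum_def closed_minkowski_sum_def by (intro closed_Un closed_UN) auto

lemma lower_sum_subset_upper_sum:
  assumes t: "t \<le> T" and H: "\<And>\<tau>. \<tau> \<in> {t0..T} \<Longrightarrow> 0 \<in> H \<tau>"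
    and B: "\<And>u v. t0 \<le> u \<Longrightarrow> u \<le> v \<Longrightarrow> v \<le> t \<Longrightarrow> B u \<subseteq> B v"
    and p: "is_partition t0 t p" and q: "is_partition t0 t q"
  shows "lower_sum t0 T B H t p \<subseteq> upper_sum t0 T B H t q"
proof -
  note pD = is_partitionD[OF p] and qD = is_partitionD[OF q]
  have "closed_minkowski_sum (increment B p i) (aumann_integral t0 T H (p ! i) t)
      \<subseteq> upper_sum t0 T B H t q" (is "closed_minkowski_sum ?A ?I \<subseteq> ?S") if i: "i \<in> {1..<length p}" for i
  proof -
    have "x + y \<in> ?S" if x: "x \<in> ?A" and y: "y \<in> ?I" for x y
    proof -
      have xi: "x \<in> B (p ! i)" using x by (simp add: increment_def)
      have ti: "t0 \<le> p ! i" "p ! i \<le> t" using pD(5,6)[of i] i by auto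
      have "x \<in> B (q ! (length q - 1))" using xi B[OF ti] qD(3) by auto
      then have ex: "\<exists>k. x \<in> B (q ! k) \<and> k < length q" using qD(1) by (intro exI[of _ "length q - 1"]) auto
      define k where "k = (LEAST k. x \<in> B (q ! k) \<and> k < length q)"
      have k: "x \<in> B (q ! k)" "k < length q" using LeastI_ex[OF ex] by (auto simp: k_def)
      have k_min: "x \<notin> B (q ! l)" if "l < k" for l
        using not_less_Least[of l "\<lambda>k. x \<in> B (q ! k) \<and> k < length q"] that k(2)
        by (auto simp: k_def[symmetric])
      show ?thesis
      proof (cases "k = 0")
        case True
        then have "x \<in> B t0" using k qD(2) by simp
        moreover have "y \<in> aumann_integral t0 T H t0 t"
          using y aumann_integral_antimono[of t0 T H t0 "p ! i" t] H ti t by auto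
        ultimately have "x + y \<in> closed_minkowski_sum (B t0) (aumann_integral t0 T H t0 t)"
          unfolding closed_minkowski_sum_def by (intro subsetD[OF closure_subset] set_plus_intro)
        then show ?thesis by (simp add: upper_sum_def)
      next
        case False
        then have nx: "x \<notin> B (q ! (k - 1))" using k_min[of "k - 1"] by simp
        have qk: "t0 \<le> q ! (k - 1)" "q ! (k - 1) \<le> t" using qD(5,6)[of "k - 1"] k by auto
        have le: "q ! (k - 1) \<le> p ! i"
        proof (rule ccontr)
          assume "\<not> ?thesis"
          then show False using B[of "p ! i" "q ! (k - 1)"] ti qk xi nx by auto
        qed
        have "x \<in> increment B q k"
          using nx k interior_subset unfolding increment_def by blast
        moreover have "y \<in> aumann_integral t0 T H (q ! (k - 1)) t"
          using y aumann_integral_antimono[of t0 T H "q ! (k - 1)" "p ! i" t] H ti t qk le by auto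
        ultimately have "x + y \<in> closed_minkowski_sum (increment B q k)
            (aumann_integral t0 T H (q ! (k - 1)) t)"
          unfolding closed_minkowski_sum_def by (intro subsetD[OF closure_subset] set_plus_intro)
        moreover have "k \<in> {1..<length q}" using False k by auto
        ultimately show ?thesis unfolding upper_sum_def by blast
      qed
    qed
    then have "?A + ?I \<subseteq> ?S" by (auto elim!: set_plus_elim)
    then show ?thesis
      unfolding closed_minkowski_sum_def using closed_upper_sum by (rule closure_minimal)
  qed
  then have "(\<Union>i\<in>{1..<length p}.
      closed_minkowski_sum (increment B p i) (aumann_integral t0 T H (p ! i) t)) \<subseteq> upper_sum t0 T B H t q"
    by (rule UN_least)
  moreover have "closed_minkowski_sum (B t0) (aumann_integral t0 T H t0 t) \<subseteq> upper_sum t0 T B H t q"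
    unfolding upper_sum_def by (rule Un_upper1)
  ultimately show ?thesis unfolding lower_sum_def by (intro Un_least)
qed

lemma upper_sum_near_lower_sum:
  assumes t: "t \<le> T" and H: "\<And>\<tau> y. \<tau> \<in> {t0..T} \<Longrightarrow> y \<in> H \<tau> \<Longrightarrow> norm y \<le> R"
    and R: "0 \<le> R" and p: "is_partition t0 t p" and e: "0 < e"
    and x: "x \<in> upper_sum t0 T B H t p"
  shows "\<exists>y\<in>lower_sum t0 T B H t p. norm (x - y) \<le> R * mesh p + e"
proof -
  note pD = is_partitionD[OF p]
  from x consider "x \<in> closed_minkowski_sum (B t0) (aumann_integral t0 T H t0 t)"
    | i where "i \<in> {1..<length p}"
        "x \<in> closed_minkowski_sum (increment B p i) (aumann_integral t0 T H (p ! (i - 1)) t)"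
    unfolding upper_sum_def by auto
  then show ?thesis
  proof cases
    case 1
    then have "x \<in> lower_sum t0 T B H t p" by (simp add: lower_sum_def)
    then show ?thesis using R e mesh_nonneg[of p] by (intro bexI[of _ x]) auto
  next
    case 2
    have i: "i - 1 < length p" "i < length p" "1 \<le> i" using 2(1) by auto
    have "\<exists>d\<in>aumann_integral t0 T H (p ! i) t. norm (c - d) \<le> R * mesh p"
      if c: "c \<in> aumann_integral t0 T H (p ! (i - 1)) t" for c
    proof -
      have "\<exists>d\<in>aumann_integral t0 T H (p ! i) t. norm (c - d) \<le> R * (p ! i - p ! (i - 1))"
        by (rule aumann_integral_near[OF H _ _ _ t c])
          (use pD(4)[of "i - 1" i] pD(5,6)[of "i - 1"] pD(6)[of i] i in auto)
      moreover have "R * (p ! i - p ! (i - 1)) \<le> R * mesh p"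
        using mesh_ge[OF i(3,2)] R by (rule mult_left_mono)
      ultimately show ?thesis by force
    qed
    from closed_minkowski_sum_near[OF 2(2) e this]
    show ?thesis using 2(1) unfolding lower_sum_def by blast
  qed
qed

lemma hausdorff_distance_le:
  assumes "\<And>a. a \<in> A \<Longrightarrow> \<exists>c\<in>C. norm (a - c) \<le> r" "\<And>c. c \<in> C \<Longrightarrow> \<exists>a\<in>A. norm (a - c) \<le> r"
  shows "hausdorff_distance A C \<le> ennreal r"
  unfolding hausdorff_distance_def
proof (intro max.boundedI SUP_least)
  fix a assume "a \<in> A"
  then obtain c where "c \<in> C" "norm (a - c) \<le> r" using assms(1) by blast
  then show "(INF c\<in>C. ennreal (norm (a - c))) \<le> ennreal r"
    by (intro INF_lower2[of c]) (auto intro: ennreal_leI)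
next
  fix c assume "c \<in> C"
  then obtain a where "a \<in> A" "norm (a - c) \<le> r" using assms(2) by blast
  then show "(INF a\<in>A. ennreal (norm (a - c))) \<le> ennreal r"
    by (intro INF_lower2[of a]) (auto intro: ennreal_leI)
qed

lemma geometric_value_exists:
  assumes t: "t0 \<le> t" "t \<le> T"
    and H0: "\<And>\<tau>. \<tau> \<in> {t0..T} \<Longrightarrow> 0 \<in> H \<tau>"
    and H: "\<And>\<tau> y. \<tau> \<in> {t0..T} \<Longrightarrow> y \<in> H \<tau> \<Longrightarrow> norm y \<le> R" and R: "0 \<le> R"
    and B: "\<And>u v. t0 \<le> u \<Longrightarrow> u \<le> v \<Longrightarrow> v \<le> t \<Longrightarrow> B u \<subseteq> B v"
  shows "geometric_value t0 T B H t (closure (\<Union>p\<in>Collect (is_partition t0 t). lower_sum t0 T B H t p))"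
    (is "geometric_value _ _ _ _ _ ?C")
  unfolding geometric_value_def
proof (intro allI impI)
  fix P assume P: "refinement_sequence t0 t P"
  let ?s = "lower_sum t0 T B H t" and ?S = "upper_sum t0 T B H t"
  have part: "is_partition t0 t (P j)" for j using P by (simp add: refinement_sequence_def)
  have lim: "(\<lambda>j. R * mesh (P j) + 1 / Suc j) \<longlonglongrightarrow> 0"
  proof -
    have "(\<lambda>j. R * mesh (P j) + 1 / Suc j) \<longlonglongrightarrow> R * 0 + 0"
      using P unfolding refinement_sequence_def
      by (intro tendsto_add tendsto_mult tendsto_const LIMSEQ_Suc[OF lim_const_over_n]) auto
    then show ?thesis by simp
  qed
  define r where "r j = R * mesh (P j) + 1 / Suc j" for j
  have r0: "0 \<le> r j" for j using R mesh_nonneg[of "P j"] by (simp add: r_def)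
  have lim_r: "r \<longlonglongrightarrow> 0" using lim by (simp add: r_def[abs_def])
  have sC: "?s p \<subseteq> ?C" if "is_partition t0 t p" for p
    by (rule order_trans[OF UN_upper closure_subset]) (use that in simp)
  have CS: "?C \<subseteq> ?S p" if "is_partition t0 t p" for p
  proof (rule closure_minimal[OF _ closed_upper_sum], rule UN_least)
    fix q assume "q \<in> Collect (is_partition t0 t)"
    then show "?s q \<subseteq> ?S p"
      by (intro lower_sum_subset_upper_sum[OF t(2) H0 B _ that]) auto
  qed
  have near: "\<exists>y\<in>?s (P j). norm (x - y) \<le> r j" if "x \<in> ?S (P j)" for x j
    unfolding r_def by (rule upper_sum_near_lower_sum[OF t(2) H R part _ that]) auto
  have cl: "x \<in> closure (\<Union>j. ?s (P j))" if x: "\<And>j. x \<in> ?S (P j)" for x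
    unfolding closure_approachable
  proof (intro allI impI)
    fix e :: real assume "0 < e"
    then obtain j where "r j < e"
      using order_tendstoD(2)[OF lim_r] by (metis eventually_sequentially order_refl)
    moreover obtain y where "y \<in> ?s (P j)" "norm (x - y) \<le> r j" using near[OF x] by blast
    ultimately show "\<exists>y\<in>\<Union>j. ?s (P j). dist y x < e"
      by (intro bexI[of _ y]) (auto simp: dist_norm norm_minus_commute)
  qed
  have lim0: "(\<lambda>j. hausdorff_distance (A j) ?C) \<longlonglongrightarrow> 0"
    if "\<And>j. hausdorff_distance (A j) ?C \<le> ennreal (r j)" for A
  proof (rule tendsto_sandwich[OF _ _ tendsto_const])
    show "(\<lambda>j. ennreal (r j)) \<longlonglongrightarrow> 0"
      using tendsto_ennrealI[OF lim_r] by simp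
  qed (use that in auto)
  have ds: "hausdorff_distance (?s (P j)) ?C \<le> ennreal (r j)" for j
  proof (rule hausdorff_distance_le)
    show "\<exists>c\<in>?C. norm (a - c) \<le> r j" if "a \<in> ?s (P j)" for a
      by (rule bexI[of _ a]) (use subsetD[OF sC[OF part[of j]] that] r0[of j] in simp_all)
    show "\<exists>a\<in>?s (P j). norm (a - c) \<le> r j" if "c \<in> ?C" for c
      using near[OF subsetD[OF CS[OF part[of j]] that]] by (simp add: norm_minus_commute)
  qed
  have dS: "hausdorff_distance (?S (P j)) ?C \<le> ennreal (r j)" for j
  proof (rule hausdorff_distance_le)
    show "\<exists>c\<in>?C. norm (a - c) \<le> r j" if "a \<in> ?S (P j)" for a
      using near[OF that] subsetD[OF sC[OF part[of j]]] by (meson bexI)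
    show "\<exists>a\<in>?S (P j). norm (a - c) \<le> r j" if "c \<in> ?C" for c
      by (rule bexI[of _ c]) (use subsetD[OF CS[OF part[of j]] that] r0[of j] in simp_all)
  qed
  have i1: "closure (\<Union>j. ?s (P j)) \<subseteq> ?C"
    by (rule closure_minimal[OF UN_least closed_closure]) (rule sC[OF part])
  have i2: "?C \<subseteq> (\<Inter>j. ?S (P j))" by (rule INT_greatest) (rule CS[OF part])
  have i3: "(\<Inter>j. ?S (P j)) \<subseteq> closure (\<Union>j. ?s (P j))"
    by (rule subsetI, rule cl) simp
  show "?C = closure (\<Union>j. ?s (P j)) \<and>
      (\<lambda>j. hausdorff_distance (?s (P j)) ?C) \<longlonglongrightarrow> 0 \<and>
      (\<lambda>j. hausdorff_distance (?S (P j)) ?C) \<longlonglongrightarrow> 0 \<and> ?C = (\<Inter>j. ?S (P j))"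
    by (intro conjI lim0[OF ds] lim0[OF dS]
      subset_antisym[OF order_trans[OF i2 i3] i1] subset_antisym[OF i2 order_trans[OF i3 i1]])
qed

theorem geometric_random_process_exists:
  fixes B G :: "'w \<Rightarrow> real \<Rightarrow> 'a::{banach, second_countable_topology} set"
  assumes B: "nucleation_process M F t0 T B" and G: "growth_process M F t0 T G"
  shows "\<exists>\<Theta>. geometric_random_process M t0 T B G \<Theta>"
proof -
  obtain K where "bounded K" and GK: "\<And>\<omega> t. \<omega> \<in> space M \<Longrightarrow> t \<in> {t0..T} \<Longrightarrow> G \<omega> t \<subseteq> K"
    using G unfolding growth_process_def by blast
  then obtain R where R: "0 < R" "\<And>y. y \<in> K \<Longrightarrow> norm y \<le> R" unfolding bounded_pos by blast
  have "geometric_random_process M t0 T B G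
      (\<lambda>\<omega> t. closure (\<Union>p\<in>Collect (is_partition t0 t). lower_sum t0 T (B \<omega>) (G \<omega>) t p))"
    unfolding geometric_random_process_def
  proof (intro ballI geometric_value_exists)
    fix \<omega> t u v assume "\<omega> \<in> space M" "t \<in> {t0..T}" "t0 \<le> u" "u \<le> v" "v \<le> t"
    then show "B \<omega> u \<subseteq> B \<omega> v"
      using B unfolding nucleation_process_def by (cases "u = v") auto
  next
    fix \<omega> t \<tau> y assume "\<omega> \<in> space M" "\<tau> \<in> {t0..T}" "y \<in> G \<omega> \<tau>"
    then show "norm y \<le> R" using GK R by blast
  qed (use G R in \<open>auto simp: growth_process_def\<close>)
  then show ?thesis by (rule exI[where P = "geometric_random_process M t0 T B G"])
qed

theorem geometric_random_process_unique:
  assumes "geometric_random_process M t0 T B G \<Theta>" "geometric_random_process M t0 T B G \<Theta>'"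
    and "\<omega> \<in> space M" "t \<in> {t0..T}"
  shows "\<Theta> \<omega> t = \<Theta>' \<omega> t"
  by (rule geometric_value_unique[of t0 t T "B \<omega>" "G \<omega>"])
    (use assms in \<open>auto simp: geometric_random_process_def\<close>)

end

theory Submission
  imports Defs
begin

text \<open>Every upper sum at time \<open>t\<close> contains \<open>B\<^sub>u + \<integral>\<^sub>u\<^sup>t G\<close> for all \<open>u \<le> t\<close>, and every lower sum is
  contained in the closure of the union of these sets over the partition points. Hence \<open>\<Theta>\<^sub>t\<close> is the
  closure of the union of \<open>B\<^sub>u + \<integral>\<^sub>u\<^sup>t G\<close> over a countable set of times, a formula free of interiors.
  Monotonicity holds for every \<open>\<omega>\<close> because \<open>0 \<in> G\<close>, and measurability reduces to that of the
  Aumann integral. The latter meets an open set \<open>U\<close> iff, for some \<open>s\<close> in a countable dense subset of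
  \<open>L\<^sup>1\<close>, the integral of the distance from \<open>s\<close> to \<open>G\<close> is smaller than the radius of a ball around
  \<open>\<integral> s\<close> inside \<open>U\<close>: a measurable selection of \<open>G\<close> near \<open>s\<close> exists. Predictability makes
  the distance jointly measurable on \<open>\<F>\<^sub>t \<otimes> lebesgue\<close>, so Tonelli applies.\<close>

section \<open>Set-valued measurability\<close>

lemma measurable_set_mapD:
  "measurable_set_map N X \<Longrightarrow> open U \<Longrightarrow> {e \<in> space N. X e \<inter> U \<noteq> {}} \<in> sets N"
  by (simp add: measurable_set_map_def)

lemma measurable_set_map_subalgebra:
  assumes "measurable_set_map N X" "sets N \<subseteq> sets N'" "space N = space N'"
  shows "measurable_set_map N' X"
  using assms unfolding measurable_set_map_def by auto

lemma measurable_set_map_compose: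
  fixes X :: "'e \<Rightarrow> 'a::topological_space set"
  assumes "measurable_set_map N X" and f: "f \<in> measurable N' N"
  shows "measurable_set_map N' (\<lambda>e. X (f e))"
  unfolding measurable_set_map_def
proof (intro allI impI)
  fix U :: "'a set" assume "open U"
  from measurable_sets[OF f measurable_set_mapD[OF assms(1) this]]
  show "{e \<in> space N'. X (f e) \<inter> U \<noteq> {}} \<in> sets N'"
    by (rule back_subst[where P = "\<lambda>A. A \<in> sets N'"]) (use measurable_space[OF f] in auto)
qed

text \<open>An open set that meets the closure of a set already meets the set, so the hitting events
  do not change.\<close>

lemma measurable_set_map_closure:
  assumes "measurable_set_map N X" shows "measurable_set_map N (\<lambda>e. closure (X e))"
  using assms unfolding measurable_set_map_def
  by (simp add: Int_commute open_Int_closure_eq_empty)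

lemma measurable_set_map_UN:
  fixes X :: "'i \<Rightarrow> 'e \<Rightarrow> 'a::topological_space set"
  assumes "countable I" and X: "\<And>i. i \<in> I \<Longrightarrow> measurable_set_map N (X i)"
  shows "measurable_set_map N (\<lambda>e. \<Union>i\<in>I. X i e)"
  unfolding measurable_set_map_def
proof (intro allI impI)
  fix U :: "'a set" assume "open U"
  then have "(\<Union>i\<in>I. {e \<in> space N. X i e \<inter> U \<noteq> {}}) \<in> sets N"
    using assms by (intro sets.countable_UN') (auto intro: measurable_set_mapD)
  then show "{e \<in> space N. (\<Union>i\<in>I. X i e) \<inter> U \<noteq> {}} \<in> sets N"
    by (rule back_subst[where P = "\<lambda>A. A \<in> sets N"]) auto
qed

text \<open>By continuity of addition, \<open>A + C\<close> meets \<open>U\<close> iff \<open>A\<close> and \<open>C\<close> meet basic open sets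
  \<open>V\<close> and \<open>W\<close> with \<open>V + W \<subseteq> U\<close>.\<close>

lemma measurable_set_map_plus:
  fixes A C :: "'e \<Rightarrow> 'a::{real_normed_vector, second_countable_topology} set"
  assumes A: "measurable_set_map N A" and C: "measurable_set_map N C"
  shows "measurable_set_map N (\<lambda>e. A e + C e)"
  unfolding measurable_set_map_def
proof (intro allI impI)
  fix U :: "'a set" assume U: "open U"
  obtain \<B> :: "'a set set" where \<B>: "countable \<B>" "topological_basis \<B>"
    by (rule ex_countable_basis[THEN exE]) blast
  define I where "I = {(V, W) \<in> \<B> \<times> \<B>. V + W \<subseteq> U}"
  have "countable I"
    by (rule countable_subset[of _ "\<B> \<times> \<B>"]) (use \<B> in \<open>auto simp: I_def\<close>)
  then have "(\<Union>(V, W)\<in>I. {e \<in> space N. A e \<inter> V \<noteq> {}} \<inter> {e \<in> space N. C e \<inter> W \<noteq> {}}) \<in> sets N"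
    using topological_basis_open[OF \<B>(2)]
    by (intro sets.countable_UN') (auto simp: I_def intro!: sets.Int measurable_set_mapD[OF A] measurable_set_mapD[OF C])
  moreover have "(A e + C e) \<inter> U \<noteq> {} \<longleftrightarrow> (\<exists>(V, W)\<in>I. A e \<inter> V \<noteq> {} \<and> C e \<inter> W \<noteq> {})" for e
  proof
    assume "(A e + C e) \<inter> U \<noteq> {}"
    then obtain a c where ac: "a \<in> A e" "c \<in> C e" "a + c \<in> U" by (auto elim!: set_plus_elim)
    have "open ((\<lambda>(x, y). x + y) -` U)"
      using U by (intro open_vimage) (auto intro!: continuous_intros simp: split_beta')
    then obtain V' W' where "open V'" "open W'" "(a, c) \<in> V' \<times> W'" "V' \<times> W' \<subseteq> (\<lambda>(x, y). x + y) -` U"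
      using ac(3) by (elim open_prod_elim) auto
    moreover from this obtain V W where "V \<in> \<B>" "a \<in> V" "V \<subseteq> V'" "W \<in> \<B>" "c \<in> W" "W \<subseteq> W'"
      using \<B>(2) by (metis mem_Sigma_iff topological_basisE)
    ultimately have "V \<in> \<B>" "W \<in> \<B>" "V \<times> W \<subseteq> (\<lambda>(x, y). x + y) -` U"
        "a \<in> A e \<inter> V" "c \<in> C e \<inter> W"
      using ac by blast+
    moreover from this have "(V, W) \<in> I"
      by (auto simp: I_def elim!: set_plus_elim)
    ultimately show "\<exists>(V, W)\<in>I. A e \<inter> V \<noteq> {} \<and> C e \<inter> W \<noteq> {}" by blast
  next
    assume "\<exists>(V, W)\<in>I. A e \<inter> V \<noteq> {} \<and> C e \<inter> W \<noteq> {}"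
    then obtain V W a c where "V + W \<subseteq> U" "a \<in> A e" "a \<in> V" "c \<in> C e" "c \<in> W"
      unfolding I_def by blast
    then show "(A e + C e) \<inter> U \<noteq> {}" by (blast intro: set_plus_intro)
  qed
  ultimately show "{e \<in> space N. (A e + C e) \<inter> U \<noteq> {}} \<in> sets N"
    by (elim back_subst[where P = "\<lambda>A. A \<in> sets N"]) auto
qed

section \<open>Distance from a measurable point to a random set\<close>

lemma infdist_less_iff:
  fixes A :: "'a::metric_space set"
  assumes "A \<noteq> {}" shows "infdist x A < r \<longleftrightarrow> (\<exists>a\<in>A. dist x a < r)"
  using assms by (simp add: infdist_notempty cINF_less_iff)

text \<open>The distance is below \<open>r\<close> iff some \<open>d\<close> in a countable dense
  set and some rational \<open>q\<close> satisfy \<open>dist (f e) d < r - q\<close> while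
  \<open>ball d q\<close> meets \<open>X e\<close>. These are countably many measurable events, and
  the point \<open>f e\<close> may vary together with the set.\<close>

lemma borel_measurable_infdist_set_map:
  fixes X :: "'e \<Rightarrow> 'a::{metric_space, second_countable_topology} set"
  assumes X: "measurable_set_map N X" and ne: "\<And>e. e \<in> space N \<Longrightarrow> X e \<noteq> {}"
    and f: "f \<in> borel_measurable N"
  shows "(\<lambda>e. infdist (f e) (X e)) \<in> borel_measurable N"
  unfolding borel_measurable_iff_less
proof
  fix r :: real
  obtain D :: "'a set" where D: "countable D" "\<And>U. open U \<Longrightarrow> U \<noteq> {} \<Longrightarrow> \<exists>d\<in>D. d \<in> U"
    using countable_dense_setE by blast
  have "(\<Union>(d, q)\<in>D \<times> \<rat>. {e \<in> space N. dist (f e) d < r - q} \<inter> {e \<in> space N. X e \<inter> ball d q \<noteq> {}}) \<in> sets N"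
    using f D(1) by (intro sets.countable_UN') (auto intro!: sets.Int measurable_set_mapD[OF X] simp: countable_rat)
  moreover have "infdist (f e) (X e) < r \<longleftrightarrow> (\<exists>d\<in>D. \<exists>q\<in>\<rat>. dist (f e) d < r - q \<and> X e \<inter> ball d q \<noteq> {})"
    if e: "e \<in> space N" for e
    unfolding infdist_less_iff[OF ne[OF e]]
  proof
    assume "\<exists>a\<in>X e. dist (f e) a < r"
    then obtain a where a: "a \<in> X e" "dist (f e) a < r" by blast
    \<comment> \<open>Half of the slack: \<open>dist a d < h\<close> then leaves room for a rational
      between \<open>dist a d\<close> and \<open>r - dist (f e) d\<close>.\<close>
    define h where "h = (r - dist (f e) a) / 2"
    have "h > 0" using a by (simp add: h_def)
    then obtain d where d: "d \<in> D" "dist a d < h" using D(2)[of "ball a h"] by force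
    have "dist (f e) d \<le> dist (f e) a + dist a d" by (rule dist_triangle)
    then have "dist a d < r - dist (f e) d" using d(2) by (simp add: h_def field_simps)
    then obtain q where "q \<in> \<rat>" "dist a d < q" "q < r - dist (f e) d" using Rats_dense_in_real by blast
    then show "\<exists>d\<in>D. \<exists>q\<in>\<rat>. dist (f e) d < r - q \<and> X e \<inter> ball d q \<noteq> {}"
      using a d by (intro bexI[of _ d] bexI[of _ q]) (auto simp: dist_commute)
  next
    assume "\<exists>d\<in>D. \<exists>q\<in>\<rat>. dist (f e) d < r - q \<and> X e \<inter> ball d q \<noteq> {}"
    then obtain d q a where "dist (f e) d < r - q" "a \<in> X e" "dist d a < q" by auto
    then show "\<exists>a\<in>X e. dist (f e) a < r"
      using dist_triangle[of "f e" a d] by (intro bexI[of _ a]) auto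
  qed
  ultimately show "{e \<in> space N. infdist (f e) (X e) < r} \<in> sets N"
    by (elim back_subst[where P = "\<lambda>A. A \<in> sets N"]) auto
qed

section \<open>Measurable selections\<close>

text \<open>Some point of \<open>X e\<close> nearly realises the distance from \<open>f e\<close>,
  and a term of a dense sequence close to it meets both requirements. Taking the least admissible
  index makes the choice measurable.\<close>

lemma selection_step:
  fixes X :: "'e \<Rightarrow> 'a::{metric_space, second_countable_topology} set"
  assumes X: "measurable_set_map N X" and ne: "\<And>e. e \<in> space N \<Longrightarrow> X e \<noteq> {}"
    and f: "f \<in> borel_measurable N" and r: "0 < r"
  shows "\<exists>g\<in>borel_measurable N. \<forall>e\<in>space N.
    infdist (g e) (X e) < r \<and> dist (f e) (g e) < infdist (f e) (X e) + r"
proof -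
  obtain D :: "'a set" where D: "countable D" "\<And>U. open U \<Longrightarrow> U \<noteq> {} \<Longrightarrow> \<exists>d\<in>D. d \<in> U"
    using countable_dense_setE by blast
  have "D \<noteq> {}" using D(2)[of UNIV] by auto
  define d where "d = from_nat_into D"
  have d: "range d = D" using \<open>D \<noteq> {}\<close> D(1) by (simp add: d_def)
  let ?P = "\<lambda>k e. infdist (d k) (X e) < r \<and> dist (f e) (d k) < infdist (f e) (X e) + r"
  have ex: "\<exists>k. ?P k e" if e: "e \<in> space N" for e
  proof -
    obtain a where a: "a \<in> X e" "dist (f e) a < infdist (f e) (X e) + r"
      using infdist_less_iff[OF ne[OF e], of "f e" "infdist (f e) (X e) + r"] r by auto
    \<comment> \<open>The minimum of two slacks: the first controls the distance from
      \<open>d k\<close> to \<open>X e\<close>, the second the distance from \<open>f e\<close> to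
      \<open>d k\<close>.\<close>
    define h where "h = min r (infdist (f e) (X e) + r - dist (f e) a)"
    have "0 < h" using a r by (simp add: h_def)
    then obtain k where k: "dist a (d k) < h"
      using D(2)[of "ball a h"] d by (metis centre_in_ball empty_iff imageE mem_ball open_ball)
    have "infdist (d k) (X e) < r"
      using a k infdist_less_iff[OF ne[OF e]] by (auto simp: h_def dist_commute)
    moreover have "dist (f e) (d k) < infdist (f e) (X e) + r"
      using k dist_triangle[of "f e" "d k" a] by (simp add: h_def)
    ultimately show ?thesis by blast
  qed
  note [measurable] = f borel_measurable_infdist_set_map[OF X ne f]
    borel_measurable_infdist_set_map[OF X ne borel_measurable_const]
  have "(\<lambda>e. LEAST k. ?P k e) \<in> measurable N (count_space UNIV)"
    by measurable
  then have "(\<lambda>e. d (LEAST k. ?P k e)) \<in> borel_measurable N"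
    by (rule measurable_compose) simp
  then show ?thesis
    using LeastI_ex[OF ex] by (intro bexI[of _ "\<lambda>e. d (LEAST k. ?P k e)"]) auto
qed

text \<open>The iteration of Kuratowski and Ryll-Nardzewski, started at \<open>f\<close>.\<close>

lemma near_measurable_selection:
  fixes X :: "'e \<Rightarrow> 'a::{complete_space, second_countable_topology} set"
  assumes X: "measurable_set_map N X" and ne: "\<And>e. e \<in> space N \<Longrightarrow> X e \<noteq> {}"
    and cl: "\<And>e. e \<in> space N \<Longrightarrow> closed (X e)"
    and f: "f \<in> borel_measurable N" and r: "0 < r"
  shows "\<exists>g\<in>borel_measurable N. \<forall>e\<in>space N. g e \<in> X e \<and> dist (f e) (g e) \<le> infdist (f e) (X e) + r"
proof -
  \<comment> \<open>The first move costs at most \<open>infdist (f e) (X e) + \<eta> 0\<close> and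
    all later moves together at most \<open>4 * \<eta> 0\<close>. The factor 1/5 makes the total
    excess at most \<open>r\<close>.\<close>
  define \<eta> where "\<eta> n = r / 5 * (1/2) ^ n" for n
  have \<eta>: "0 < \<eta> n" for n using r by (simp add: \<eta>_def)
  have "\<exists>h. \<forall>n. (h n \<in> borel_measurable N \<and> (n = 0 \<longrightarrow> h n = f)) \<and>
    (\<forall>e\<in>space N. infdist (h (Suc n) e) (X e) < \<eta> n \<and>
      dist (h n e) (h (Suc n) e) < infdist (h n e) (X e) + \<eta> n)"
    by (rule dependent_nat_choice) (use f selection_step[OF X ne _ \<eta>] in \<open>auto simp: Bex_def\<close>)
  then obtain h where h: "\<And>n. h n \<in> borel_measurable N" "h 0 = f"
    "\<And>n e. e \<in> space N \<Longrightarrow> infdist (h (Suc n) e) (X e) < \<eta> n"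
    "\<And>n e. e \<in> space N \<Longrightarrow> dist (h n e) (h (Suc n) e) < infdist (h n e) (X e) + \<eta> n" by metis
  \<comment> \<open>The count starts at \<open>Suc n\<close> because nothing bounds the distance
    from the starting point \<open>f e\<close> to \<open>X e\<close>.\<close>
  have step: "dist (h (Suc n) e) (h (Suc (Suc n)) e) \<le> 2 * \<eta> n" if "e \<in> space N" for n e
    using h(3)[OF that, of n] h(4)[OF that, of "Suc n"] \<eta>[of n] by (simp add: \<eta>_def)
  \<comment> \<open>The bounds \<open>2 * \<eta> (n + i)\<close> of the single moves add up to this
    telescoping difference; keeping the negative term lets the induction close.\<close>
  have tail: "dist (h (Suc n) e) (h (Suc n + k) e) \<le> 4 * \<eta> n - 4 * \<eta> (n + k)" if e: "e \<in> space N" for n k e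
  proof (induction k)
    case (Suc k)
    have "4 * \<eta> (n + k) - 4 * \<eta> (n + Suc k) = 2 * \<eta> (n + k)" by (simp add: \<eta>_def)
    with Suc step[OF e, of "n + k"] show ?case
      using dist_triangle[of "h (Suc n) e" "h (Suc n + Suc k) e" "h (Suc n + k) e"] by simp
  qed simp
  have tail': "dist (h (Suc n) e) (h (Suc n + k) e) \<le> 4 * \<eta> n" if "e \<in> space N" for n k e
    using tail[OF that, of n k] \<eta>[of "n + k"] by simp
  have \<eta>0: "\<eta> \<longlonglongrightarrow> 0"
    unfolding \<eta>_def by (rule tendsto_mult_right_zero) (simp add: LIMSEQ_power_zero)
  have Cauchy: "Cauchy (\<lambda>n. h n e)" if e: "e \<in> space N" for e
  proof (rule metric_CauchyI)
    fix \<epsilon> :: real assume "0 < \<epsilon>"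
    then obtain n where n: "\<eta> n < \<epsilon> / 8"
      using order_tendstoD(2)[OF \<eta>0, of "\<epsilon> / 8"] by (auto simp: eventually_sequentially)
    have "dist (h (Suc n) e) (h m e) < \<epsilon> / 2" if "m \<ge> Suc n" for m
      using tail'[OF e, of n "m - Suc n"] that n by simp
    then have "dist (h m e) (h m' e) < \<epsilon>" if "m \<ge> Suc n" "m' \<ge> Suc n" for m m'
      using that dist_triangle_half_r by blast
    then show "\<exists>K. \<forall>m\<ge>K. \<forall>m'\<ge>K. dist (h m e) (h m' e) < \<epsilon>" by blast
  qed
  define g where "g e = lim (\<lambda>n. h n e)" for e
  have lim: "(\<lambda>n. h n e) \<longlonglongrightarrow> g e" if "e \<in> space N" for e
    unfolding g_def using Cauchy[OF that] by (simp add: Cauchy_convergent_iff convergent_LIMSEQ_iff)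
  have "g \<in> borel_measurable N" by (rule borel_measurable_LIMSEQ_metric[OF h(1) lim])
  \<comment> \<open>The distance to \<open>X e\<close> is continuous and tends to zero along the
    iterates, and a closed non-empty set contains every point at distance zero.\<close>
  moreover have "g e \<in> X e" if e: "e \<in> space N" for e
  proof -
    have "(\<lambda>n. infdist (h (Suc n) e) (X e)) \<longlonglongrightarrow> infdist (g e) (X e)"
      by (intro tendsto_infdist LIMSEQ_Suc lim e)
    moreover have "(\<lambda>n. infdist (h (Suc n) e) (X e)) \<longlonglongrightarrow> 0"
      by (rule tendsto_sandwich[OF _ _ tendsto_const \<eta>0])
        (auto intro!: always_eventually infdist_nonneg less_imp_le[OF h(3)[OF e]])
    ultimately have "infdist (g e) (X e) = 0" by (rule LIMSEQ_unique)
    then show ?thesis using in_closed_iff_infdist_zero[OF cl[OF e] ne[OF e]] by simp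
  qed
  moreover have "dist (f e) (g e) \<le> infdist (f e) (X e) + r" if e: "e \<in> space N" for e
  proof (rule LIMSEQ_le_const2)
    show "(\<lambda>n. dist (f e) (h n e)) \<longlonglongrightarrow> dist (f e) (g e)"
      by (intro tendsto_dist tendsto_const lim e)
    have "dist (f e) (h n e) \<le> infdist (f e) (X e) + r" if "n \<ge> 1" for n
    proof -
      have "dist (f e) (h (Suc 0) e) < infdist (f e) (X e) + \<eta> 0" using h(4)[OF e, of 0] h(2) by simp
      moreover have "dist (h (Suc 0) e) (h n e) \<le> 4 * \<eta> 0 - 4 * \<eta> (n - 1)"
        using tail[OF e, of 0 "n - 1"] that by simp
      ultimately show ?thesis
        using dist_triangle[of "f e" "h n e" "h (Suc 0) e"] \<eta>[of "n - 1"] by (simp add: \<eta>_def)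
    qed
    then show "\<exists>n0. \<forall>n\<ge>n0. dist (f e) (h n e) \<le> infdist (f e) (X e) + r" by blast
  qed
  ultimately show ?thesis by blast
qed

section \<open>A countable dense family of integrable functions\<close>

text \<open>Outer regularity gives an open \<open>U\<close> around \<open>A\<close> with small
  excess. \<open>U\<close> is a countable union of basic open sets, and finitely many of them
  already exhaust its measure up to \<open>e/2\<close>. Finite unions matter because a countable
  basis has only countably many of them.\<close>

lemma lebesgue_approx_open:
  fixes A :: "'b::euclidean_space set" and \<B> :: "'b set set"
  assumes \<B>: "countable \<B>" "topological_basis \<B>" and A: "A \<in> lmeasurable" and e: "0 < e"
  shows "\<exists>\<F>. finite \<F> \<and> \<F> \<subseteq> \<B> \<and> \<Union>\<F> \<in> lmeasurable \<and> measure lebesgue (sym_diff A (\<Union>\<F>)) < e"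
proof -
  obtain U where U: "open U" "A \<subseteq> U" "U - A \<in> lmeasurable" "emeasure lebesgue (U - A) < ennreal (e/2)"
    using sets_lebesgue_outer_open[of A "e/2"] A e by (auto simp: fmeasurable_def)
  have "U = A \<union> (U - A)" using U by auto
  then have Um: "U \<in> lmeasurable" using A U(3) fmeasurable.Un by metis
  have UA: "measure lebesgue (U - A) < e/2"
    using U(3,4) e by (simp add: emeasure_eq_measure2 ennreal_less_iff)
  obtain \<D> where \<D>: "\<D> \<subseteq> \<B>" "\<Union>\<D> = U"
    using \<B>(2) U(1) unfolding topological_basis_def by auto
  have Dm: "d \<in> lmeasurable" if "d \<in> \<D>" for d
    by (rule fmeasurableI2[OF Um]) (use that \<D> topological_basis_open[OF \<B>(2)] in \<open>auto intro: borel_open\<close>)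
  have sub: "\<Union>\<F> \<in> lmeasurable" "\<Union>\<F> \<subseteq> U" if "\<F> \<subseteq> \<D>" "finite \<F>" for \<F>
    using that Dm \<D> by (auto intro!: fmeasurable.finite_Union)
  obtain \<F> where \<F>: "\<F> \<subseteq> \<D>" "finite \<F>" "measure lebesgue (\<Union>\<D>) - e/2 < measure lebesgue (\<Union>\<F>)"
  proof (rule measure_countable_Union_approachable[of \<D> "e/2" "measure lebesgue U"])
    show "countable \<D>" using \<B>(1) \<D>(1) by (rule countable_subset[rotated])
    show "measure lebesgue (\<Union>D') \<le> measure lebesgue U" if "D' \<subseteq> \<D>" "finite D'" for D'
      using sub[OF that] Um by (intro measure_mono_fmeasurable) (auto simp: fmeasurableD)
  qed (use Dm e in simp_all)
  note sub = sub[OF \<F>(1,2)]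
  have m: "measure lebesgue (U - \<Union>\<F>) < e/2"
    using \<F>(3) sub Um by (simp add: \<D>(2) measurable_measure_Diff fmeasurableD)
  have Uf: "U - \<Union>\<F> \<in> lmeasurable" using Um sub by (simp add: fmeasurable_Diff fmeasurableD)
  have "measure lebesgue (sym_diff A (\<Union>\<F>)) \<le> measure lebesgue ((U - A) \<union> (U - \<Union>\<F>))"
    by (rule measure_mono_fmeasurable)
      (use U(2,3) sub Uf A in \<open>auto intro!: fmeasurable.Un sets.Un sets.Diff fmeasurableD\<close>)
  also have "\<dots> \<le> measure lebesgue (U - A) + measure lebesgue (U - \<Union>\<F>)"
    using U(3) Uf by (intro measure_Un_le) auto
  finally show ?thesis
    using UA m \<F> \<D> sub by (intro exI[of _ \<F>]) auto
qed

text \<open>The family consists of step functions with values in a countable dense set, on finite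
  unions of basic open sets. Density is proved by induction over scaled indicators, sums and
  dominated limits.\<close>

lemma countable_L1_dense:
  obtains S :: "('b::euclidean_space \<Rightarrow> 'a::{banach, second_countable_topology}) set"
  where "countable S" "\<And>s. s \<in> S \<Longrightarrow> integrable lebesgue s"
    "\<And>f \<epsilon>. integrable lebesgue f \<Longrightarrow> 0 < \<epsilon> \<Longrightarrow> \<exists>s\<in>S. (LINT x|lebesgue. norm (f x - s x)) < \<epsilon>"
proof -
  obtain \<B> :: "'b set set" where \<B>: "countable \<B>" "topological_basis \<B>"
    by (rule ex_countable_basis[THEN exE]) blast
  obtain D :: "'a set" where D: "countable D" "\<And>U. open U \<Longrightarrow> U \<noteq> {} \<Longrightarrow> \<exists>d\<in>D. d \<in> U"
    using countable_dense_setE by blast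
  define \<U> where "\<U> = {U \<in> Union ` {\<F>. finite \<F> \<and> \<F> \<subseteq> \<B>}. U \<in> lmeasurable}"
  \<comment> \<open>With lists as codes, countability reduces to that of lists over a countable set,
    and the sum of two step functions is coded by appending.\<close>
  define st where "st l x = (\<Sum>(U, c)\<leftarrow>l. indicator U x *\<^sub>R c)" for l :: "('b set \<times> 'a) list" and x
  define S where "S = st ` lists (\<U> \<times> D)"
  have "countable \<U>"
    by (rule countable_subset[OF _ countable_image[OF countable_Collect_finite_subset[OF \<B>(1)], of Union]])
      (auto simp: \<U>_def)
  then have "countable S" unfolding S_def using D(1) by auto
  moreover have int: "integrable lebesgue s" if "s \<in> S" for s
  proof -
    have "integrable lebesgue (st l)" if "l \<in> lists (\<U> \<times> D)" for l
      using that
    proof (induction l)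
      case (Cons a l)
      obtain U c where a: "a = (U, c)" by (cases a)
      have "integrable lebesgue (\<lambda>x. indicator U x *\<^sub>R c)"
        using Cons(1) a by (auto simp: \<U>_def fmeasurable_def)
      then show ?case using Cons.IH a by (simp add: st_def[abs_def])
    qed (simp add: st_def[abs_def])
    then show ?thesis using that by (auto simp: S_def)
  qed
  moreover have "\<exists>s\<in>S. (LINT x|lebesgue. norm (f x - s x)) < \<epsilon>" if "integrable lebesgue f" "0 < \<epsilon>" for f \<epsilon>
    using that
  proof (induction f arbitrary: \<epsilon>)
    case (base A c)
    have A: "A \<in> lmeasurable" using base by (simp add: fmeasurable_def)
    \<comment> \<open>One half of \<open>\<epsilon>\<close> pays for replacing \<open>A\<close> by
      \<open>U\<close>, the other for replacing \<open>c\<close> by \<open>d\<close>. Adding one to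
      \<open>norm c\<close>, and below to the measure of \<open>U\<close>, avoids zero
      denominators.\<close>
    obtain \<F> where \<F>: "finite \<F>" "\<F> \<subseteq> \<B>" "\<Union>\<F> \<in> lmeasurable"
        "measure lebesgue (sym_diff A (\<Union>\<F>)) < \<epsilon> / (2 * (norm c + 1))"
      using lebesgue_approx_open[OF \<B> A, of "\<epsilon> / (2 * (norm c + 1))"] base by (auto simp: add_nonneg_pos)
    define U where "U = \<Union>\<F>"
    have U: "U \<in> \<U>" "U \<in> lmeasurable" using \<F> by (auto simp: U_def \<U>_def)
    have AU: "sym_diff A U \<in> lmeasurable" using A U by (auto intro: fmeasurable.Un fmeasurable_Diff fmeasurableD)
    have mU: "0 < 2 * (measure lebesgue U + 1)" by (simp add: add_nonneg_pos)
    then have "0 < \<epsilon> / (2 * (measure lebesgue U + 1))" using base by simp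
    then obtain d where d: "d \<in> D" "norm (c - d) < \<epsilon> / (2 * (measure lebesgue U + 1))"
      using D(2)[OF open_ball, of c] by (metis centre_in_ball dist_norm empty_iff mem_ball)
    \<comment> \<open>The integrands are compared pointwise. On \<open>U - A\<close> the difference
      has norm \<open>norm d\<close>, which is at most \<open>norm c + norm (c - d)\<close>.\<close>
    have "(LINT x|lebesgue. norm (indicator A x *\<^sub>R c - st [(U, d)] x)) \<le>
        (LINT x|lebesgue. norm c * indicator (sym_diff A U) x + norm (c - d) * indicator U x)"
    proof (rule integral_mono)
      show "integrable lebesgue (\<lambda>x. norm (indicator A x *\<^sub>R c - st [(U, d)] x))"
        using A U by (auto simp: st_def fmeasurable_def intro!: integrable_norm Bochner_Integration.integrable_diff)
      show "integrable lebesgue (\<lambda>x. norm c * indicator (sym_diff A U) x + norm (c - d) * indicator U x)"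
        using AU U by (intro Bochner_Integration.integrable_add integrable_mult_right integrable_real_indicator)
          (simp_all add: fmeasurable_def del: emeasure_completion)
    qed (use norm_triangle_ineq4[of c "c - d"] in \<open>auto simp: st_def indicator_def\<close>)
    also have "\<dots> = norm c * measure lebesgue (sym_diff A U) + norm (c - d) * measure lebesgue U"
      using AU U by (subst Bochner_Integration.integral_add)
        (auto simp: fmeasurable_def intro!: integrable_mult_right integrable_real_indicator)
    also have "\<dots> < \<epsilon>"
    proof -
      have "norm c * measure lebesgue (sym_diff A U) \<le> (norm c + 1) * measure lebesgue (sym_diff A U)"
        by (intro mult_right_mono) auto
      also have "\<dots> < \<epsilon> / 2"
        using iffD1[OF pos_less_divide_eq \<F>(4)] norm_ge_zero[of c] by (simp add: U_def algebra_simps)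
      finally have "norm c * measure lebesgue (sym_diff A U) < \<epsilon> / 2" .
      moreover have "norm (c - d) * measure lebesgue U \<le> norm (c - d) * (measure lebesgue U + 1)"
        by (intro mult_left_mono) auto
      moreover have "norm (c - d) * (measure lebesgue U + 1) < \<epsilon> / 2"
        using d(2) mU by (simp only: pos_less_divide_eq)
      ultimately show ?thesis by linarith
    qed
    finally show ?case using U d unfolding S_def by (intro bexI[of _ "st [(U, d)]"] imageI) auto
  next
    case (add f g)
    obtain s where s: "s \<in> S" "(LINT x|lebesgue. norm (f x - s x)) < \<epsilon> / 2"
      using add.IH(1)[of "\<epsilon> / 2"] add.prems by auto
    obtain r where r: "r \<in> S" "(LINT x|lebesgue. norm (g x - r x)) < \<epsilon> / 2"
      using add.IH(2)[of "\<epsilon> / 2"] add.prems by auto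
    note i = int[OF s(1)] int[OF r(1)] add.hyps
    have "(LINT x|lebesgue. norm (f x + g x - (s x + r x))) \<le>
        (LINT x|lebesgue. norm (f x - s x) + norm (g x - r x))"
      using i by (intro integral_mono) (auto intro: norm_diff_triangle_ineq)
    also have "\<dots> = (LINT x|lebesgue. norm (f x - s x)) + (LINT x|lebesgue. norm (g x - r x))"
      using i by (intro Bochner_Integration.integral_add) auto
    also have "\<dots> < \<epsilon>" using s r by simp
    finally have "(LINT x|lebesgue. norm (f x + g x - (s x + r x))) < \<epsilon>" .
    moreover obtain l m where l: "l \<in> lists (\<U> \<times> D)" "s = st l" "m \<in> lists (\<U> \<times> D)" "r = st m"
      using s(1) r(1) by (auto simp: S_def)
    then have "(\<lambda>x. s x + r x) = st (l @ m)" by (simp add: st_def fun_eq_iff)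
    then have "(\<lambda>x. s x + r x) \<in> S" using l by (simp add: S_def)
    ultimately show ?case by (intro bexI[of _ "\<lambda>x. s x + r x"])
  next
    case (lim f u)
    have "(\<lambda>i. LINT x|lebesgue. norm (f x - u i x)) \<longlonglongrightarrow> (LINT x::'b|lebesgue. (0::real))"
    proof (rule integral_dominated_convergence[where f = "\<lambda>_. 0" and s = "\<lambda>i x. norm (f x - u i x)"])
      \<comment> \<open>The approximants satisfy \<open>norm (u i x) \<le> 2 * norm (f x)\<close>,
        hence the constant 3 in the dominating function.\<close>
      show "integrable lebesgue (\<lambda>x. 3 * norm (f x))" using lim.hyps by auto
      show "AE x in lebesgue. (\<lambda>i. norm (f x - u i x)) \<longlonglongrightarrow> 0"
        by (intro AE_I2) (auto intro!: tendsto_eq_intros lim.hyps(2))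
      show "AE x in lebesgue. norm (norm (f x - u i x)) \<le> 3 * norm (f x)" for i
      proof (rule AE_I2)
        fix x show "norm (norm (f x - u i x)) \<le> 3 * norm (f x)"
          using lim.hyps(3)[of x i] norm_triangle_ineq4[of "f x" "u i x"] by simp
      qed
    qed (use lim.hyps in \<open>auto simp: borel_measurable_integrable\<close>)
    then obtain i where i: "(LINT x|lebesgue. norm (f x - u i x)) < \<epsilon> / 2"
      using order_tendstoD(2)[of _ _ sequentially "\<epsilon> / 2"] lim.prems
      by (fastforce simp: eventually_sequentially)
    obtain s where s: "s \<in> S" "(LINT x|lebesgue. norm (u i x - s x)) < \<epsilon> / 2"
      using lim.IH[of "\<epsilon> / 2" i] lim.prems by auto
    note I = int[OF s(1)] lim.hyps(1)[of i] \<open>integrable lebesgue f\<close>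
    have "(LINT x|lebesgue. norm (f x - s x)) \<le>
        (LINT x|lebesgue. norm (f x - u i x) + norm (u i x - s x))"
    proof (rule integral_mono)
      show "norm (f x - s x) \<le> norm (f x - u i x) + norm (u i x - s x)" for x
        using norm_triangle_ineq[of "f x - u i x" "u i x - s x"] by simp
    qed (use I in auto)
    also have "\<dots> = (LINT x|lebesgue. norm (f x - u i x)) + (LINT x|lebesgue. norm (u i x - s x))"
      using I by (intro Bochner_Integration.integral_add) auto
    also have "\<dots> < \<epsilon>" using s i by simp
    finally show ?case using s by blast
  qed
  ultimately show thesis by (rule that)
qed

section \<open>The geometric value without increments\<close>

text \<open>A selection set to zero after \<open>s\<close> is still a selection, as zero lies in
  every \<open>H \<tau>\<close>, and its integral up to \<open>t\<close> is the old integral up to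
  \<open>s\<close>.\<close>

lemma aumann_integral_mono_right:
  assumes H: "\<And>\<tau>. \<tau> \<in> {t0..T} \<Longrightarrow> 0 \<in> H \<tau>" and st: "s \<le> t"
  shows "aumann_integral t0 T H a s \<subseteq> aumann_integral t0 T H a t"
proof
  fix x assume "x \<in> aumann_integral t0 T H a s"
  then obtain g where g: "integrable (lebesgue_on {t0..T}) g"
      "AE \<tau> in lebesgue_on {t0..T}. g \<tau> \<in> H \<tau>" "x = integral\<^sup>L (lebesgue_on {a..s}) g"
    unfolding aumann_integral_def by auto
  define h where "h \<tau> = indicator {..s} \<tau> *\<^sub>R g \<tau>" for \<tau>
  have "{..s} \<inter> {t0..T} \<in> sets (lebesgue_on {t0..T})"
    by (auto simp: sets_restrict_space intro!: image_eqI[where x="{..s}"])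
  then have "integrable (lebesgue_on {t0..T}) (\<lambda>\<tau>. indicator ({..s} \<inter> {t0..T}) \<tau> *\<^sub>R g \<tau>)"
    using g(1) by (rule integrable_mult_indicator)
  moreover have "integrable (lebesgue_on {t0..T}) h \<longleftrightarrow>
      integrable (lebesgue_on {t0..T}) (\<lambda>\<tau>. indicator ({..s} \<inter> {t0..T}) \<tau> *\<^sub>R g \<tau>)"
    by (rule Bochner_Integration.integrable_cong) (auto simp: h_def indicator_def space_restrict_space)
  ultimately have 1: "integrable (lebesgue_on {t0..T}) h" by simp
  have 2: "AE \<tau> in lebesgue_on {t0..T}. h \<tau> \<in> H \<tau>"
    using g(2) AE_space
    by eventually_elim (auto simp: h_def indicator_def space_restrict_space intro: H)
  have "integral\<^sup>L (lebesgue_on {a..t}) h = integral\<^sup>L lebesgue (\<lambda>\<tau>. indicator {a..t} \<tau> *\<^sub>R h \<tau>)"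
    by (rule integral_restrict_space) auto
  also have "\<dots> = integral\<^sup>L lebesgue (\<lambda>\<tau>. indicator {a..s} \<tau> *\<^sub>R g \<tau>)"
    by (rule Bochner_Integration.integral_cong) (use st in \<open>auto simp: h_def indicator_def\<close>)
  also have "\<dots> = integral\<^sup>L (lebesgue_on {a..s}) g"
    by (rule integral_restrict_space[symmetric]) auto
  finally show "x \<in> aumann_integral t0 T H a t"
    using 1 2 unfolding aumann_integral_def g(3) by (intro CollectI exI[of _ h] conjI) simp_all
qed

lemma refinement_sequence_mem:
  assumes "refinement_sequence t0 t P" "u \<in> set (P j)"
  shows "t0 \<le> u" "u \<le> t"
proof -
  obtain i where "i < length (P j)" "u = P j ! i" using assms(2) by (auto simp: in_set_conv_nth)
  moreover have "is_partition t0 t (P j)" using assms(1) by (simp add: refinement_sequence_def)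
  ultimately show "t0 \<le> u" "u \<le> t" using is_partitionD(5,6) by blast+
qed

lemma set_plus_subset_closed_minkowski_sum: "A + C \<subseteq> closed_minkowski_sum A C"
  unfolding closed_minkowski_sum_def by (rule closure_subset)

text \<open>A point born by time \<open>u\<close> is collected by the first increment of \<open>q\<close> whose right end
  already contains it, and the growth integral there starts no later than \<open>u\<close>.\<close>

lemma set_plus_subset_upper_sum:
  assumes t: "t \<le> T" and H: "\<And>\<tau>. \<tau> \<in> {t0..T} \<Longrightarrow> 0 \<in> H \<tau>"
    and B: "\<And>u v. t0 \<le> u \<Longrightarrow> u \<le> v \<Longrightarrow> v \<le> t \<Longrightarrow> B u \<subseteq> B v"
    and q: "is_partition t0 t q" and u: "t0 \<le> u" "u \<le> t"
  shows "B u + aumann_integral t0 T H u t \<subseteq> upper_sum t0 T B H t q"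
proof
  fix z assume "z \<in> B u + aumann_integral t0 T H u t"
  then obtain x y where x: "x \<in> B u" and y: "y \<in> aumann_integral t0 T H u t" and z: "z = x + y"
    by (auto elim: set_plus_elim)
  note qD = is_partitionD[OF q]
  let ?P = "\<lambda>k. x \<in> B (q ! k) \<and> k < length q"
  have ex: "?P (length q - 1)" using B[of u t] u x qD(1,3) by auto
  define k where "k = Least ?P"
  have k: "x \<in> B (q ! k)" "k < length q" using LeastI[of ?P, OF ex] by (auto simp: k_def)
  have y': "y \<in> aumann_integral t0 T H a t" if "t0 \<le> a" "a \<le> u" for a
    using y aumann_integral_antimono[of t0 T H a u t] H that u t by auto
  show "z \<in> upper_sum t0 T B H t q"
  proof (cases "k = 0")
    case True
    then have "z \<in> B t0 + aumann_integral t0 T H t0 t"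
      using k qD(2) y'[of t0] u z by (auto intro: set_plus_intro)
    then show ?thesis
      using set_plus_subset_closed_minkowski_sum[of "B t0"] unfolding upper_sum_def by (intro UnI1) (rule subsetD)
  next
    case False
    then have nx: "x \<notin> B (q ! (k - 1))"
      using not_less_Least[of "k - 1" ?P, folded k_def] k(2) by auto
    have qk: "t0 \<le> q ! (k - 1)" "q ! (k - 1) \<le> t" using qD(5,6)[of "k - 1"] k by auto
    \<comment> \<open>Otherwise monotonicity of \<open>B\<close> would carry \<open>x\<close> from
      \<open>B u\<close> into \<open>B (q ! (k - 1))\<close>, against the minimality of
      \<open>k\<close>.\<close>
    have "q ! (k - 1) \<le> u"
      using B[of u "q ! (k - 1)"] u(1) qk(2) x nx by (metis linear subsetD)
    moreover have "x \<in> increment B q k"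
      using nx k interior_subset unfolding increment_def by blast
    ultimately have "z \<in> increment B q k + aumann_integral t0 T H (q ! (k - 1)) t"
      using y' qk z by (auto intro: set_plus_intro)
    then have "z \<in> closed_minkowski_sum (increment B q k) (aumann_integral t0 T H (q ! (k - 1)) t)"
      by (rule subsetD[OF set_plus_subset_closed_minkowski_sum])
    then show ?thesis
      unfolding upper_sum_def using False k(2) by (intro UnI2 UN_I[of k]) auto
  qed
qed

text \<open>The geometric value is an intersection of upper sums, each of which contains the
  set.\<close>

lemma set_plus_subset_geometric_value:
  assumes "t \<le> T" and "\<And>\<tau>. \<tau> \<in> {t0..T} \<Longrightarrow> 0 \<in> H \<tau>"
    and "\<And>u v. t0 \<le> u \<Longrightarrow> u \<le> v \<Longrightarrow> v \<le> t \<Longrightarrow> B u \<subseteq> B v"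
    and C: "geometric_value t0 T B H t C" and u: "t0 \<le> u" "u \<le> t"
  shows "B u + aumann_integral t0 T H u t \<subseteq> C"
proof -
  obtain P where P: "refinement_sequence t0 t P"
    using refinement_sequence_exists u by (meson order_trans)
  then have "C = (\<Inter>j. upper_sum t0 T B H t (P j))" using C unfolding geometric_value_def by blast
  moreover have "B u + aumann_integral t0 T H u t \<subseteq> upper_sum t0 T B H t (P j)" for j
    using P by (intro set_plus_subset_upper_sum assms) (auto simp: refinement_sequence_def)
  ultimately show ?thesis by blast
qed

text \<open>Putting the removed interior back only enlarges an increment to
  \<open>B (p ! i)\<close>, and one outer closure absorbs the closures of the summands.\<close>

lemma lower_sum_subset:
  assumes p: "is_partition t0 t p"
  shows "lower_sum t0 T B H t p \<subseteq> closure (\<Union>u\<in>set p. B u + aumann_integral t0 T H u t)"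
proof -
  have "closed_minkowski_sum (B t0) (aumann_integral t0 T H t0 t)
      \<subseteq> closure (\<Union>u\<in>set p. B u + aumann_integral t0 T H u t)"
    unfolding closed_minkowski_sum_def using is_partitionD(1,2)[OF p]
    by (intro closure_mono UN_upper[of t0]) (metis nth_mem)
  moreover have "closed_minkowski_sum (increment B p i) (aumann_integral t0 T H (p ! i) t)
      \<subseteq> closure (\<Union>u\<in>set p. B u + aumann_integral t0 T H u t)" if "i < length p" for i
  proof -
    have "increment B p i + aumann_integral t0 T H (p ! i) t \<subseteq> B (p ! i) + aumann_integral t0 T H (p ! i) t"
      by (rule set_plus_mono2) (auto simp: increment_def)
    then show ?thesis
      unfolding closed_minkowski_sum_def
      by (rule closure_mono[OF order_trans[OF _ UN_upper[OF nth_mem[OF that]]]])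
  qed
  ultimately show ?thesis unfolding lower_sum_def by (intro Un_least UN_least) simp_all
qed

text \<open>The value is the closure of the union of the lower sums, which gives one inclusion, and
  the intersection of the upper sums, which gives the other. The times that remain form a countable
  set determined by \<open>P\<close> alone, as measurability requires.\<close>

lemma geometric_value_eq_closure:
  assumes t: "t \<le> T" and H: "\<And>\<tau>. \<tau> \<in> {t0..T} \<Longrightarrow> 0 \<in> H \<tau>"
    and B: "\<And>u v. t0 \<le> u \<Longrightarrow> u \<le> v \<Longrightarrow> v \<le> t \<Longrightarrow> B u \<subseteq> B v"
    and C: "geometric_value t0 T B H t C" and P: "refinement_sequence t0 t P"
  shows "C = closure (\<Union>u\<in>(\<Union>j. set (P j)). B u + aumann_integral t0 T H u t)"
proof (rule antisym)
  have part: "is_partition t0 t (P j)" for j using P by (simp add: refinement_sequence_def)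
  have CP: "C = closure (\<Union>j. lower_sum t0 T B H t (P j))"
    using C P unfolding geometric_value_def by blast
  have "lower_sum t0 T B H t (P j) \<subseteq> closure (\<Union>u\<in>(\<Union>j. set (P j)). B u + aumann_integral t0 T H u t)" for j
    by (rule order_trans[OF lower_sum_subset[OF part] closure_mono], rule UN_mono) auto
  then show "C \<subseteq> closure (\<Union>u\<in>(\<Union>j. set (P j)). B u + aumann_integral t0 T H u t)"
    unfolding CP by (intro closure_minimal UN_least closed_closure)
  have "B u + aumann_integral t0 T H u t \<subseteq> C" if u: "u \<in> set (P j)" for u j
    by (rule set_plus_subset_geometric_value[OF t H B C refinement_sequence_mem[OF P u]])
  then show "closure (\<Union>u\<in>(\<Union>j. set (P j)). B u + aumann_integral t0 T H u t) \<subseteq> C"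
    by (intro closure_minimal UN_least) (auto simp: CP)
qed

text \<open>Each set \<open>B u + aumann_integral t0 T H u s\<close> grows when \<open>s\<close> is
  replaced by \<open>t\<close>, and then lies in the closed set \<open>D\<close>; the closure of
  their union is \<open>C\<close>.\<close>

lemma geometric_value_mono:
  assumes s: "t0 \<le> s" "s \<le> t" and t: "t \<le> T" and H: "\<And>\<tau>. \<tau> \<in> {t0..T} \<Longrightarrow> 0 \<in> H \<tau>"
    and B: "\<And>u v. t0 \<le> u \<Longrightarrow> u \<le> v \<Longrightarrow> v \<le> t \<Longrightarrow> B u \<subseteq> B v"
    and C: "geometric_value t0 T B H s C" and D: "geometric_value t0 T B H t D"
  shows "C \<subseteq> D"
proof -
  obtain P where P: "refinement_sequence t0 s P" using refinement_sequence_exists[OF s(1)] ..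
  \<comment> \<open>This sequence serves only to see that \<open>D\<close> is closed.\<close>
  obtain Q where "refinement_sequence t0 t Q" using refinement_sequence_exists s by (meson order_trans)
  then have "closed D" using geometric_value_eq_closure[OF t H B D] by (metis closed_closure)
  have "C = closure (\<Union>u\<in>(\<Union>j. set (P j)). B u + aumann_integral t0 T H u s)"
    by (rule geometric_value_eq_closure[OF _ H B C P]) (use s t in auto)
  also have "\<dots> \<subseteq> D"
  proof (intro closure_minimal UN_least \<open>closed D\<close>)
    fix u assume "u \<in> (\<Union>j. set (P j))"
    then have u: "t0 \<le> u" "u \<le> s"
      using refinement_sequence_mem[OF P] by auto
    have "B u + aumann_integral t0 T H u s \<subseteq> B u + aumann_integral t0 T H u t"
      by (intro set_plus_mono2 aumann_integral_mono_right H s) auto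
    also have "\<dots> \<subseteq> D"
      by (rule set_plus_subset_geometric_value[OF t H B D]) (use u s in auto)
    finally show "B u + aumann_integral t0 T H u s \<subseteq> D" .
  qed
  finally show ?thesis .
qed

section \<open>Measurability of the Aumann integral\<close>

text \<open>The integral of the distance from \<open>s\<close> to \<open>H\<close> is, up to an
  arbitrarily small error, the cost of replacing \<open>s\<close> by a selection. Quantifying over
  selections thus becomes quantifying over the dense family \<open>S\<close> and rational
  radii.\<close>

lemma aumann_integral_hits_iff:
  fixes H :: "real \<Rightarrow> 'a::{banach, second_countable_topology} set"
  assumes ut: "t0 \<le> u" "u \<le> t" "t \<le> T"
    and meas: "measurable_set_map (lebesgue_on {t0..T}) H"
    and cl: "\<And>\<tau>. \<tau> \<in> {t0..T} \<Longrightarrow> closed (H \<tau>)" and ne: "\<And>\<tau>. \<tau> \<in> {t0..T} \<Longrightarrow> H \<tau> \<noteq> {}"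
    and R: "\<And>\<tau> y. \<tau> \<in> {t0..T} \<Longrightarrow> y \<in> H \<tau> \<Longrightarrow> norm y \<le> R"
    and S: "\<And>s. s \<in> S \<Longrightarrow> integrable lebesgue s"
      "\<And>f \<epsilon>. integrable lebesgue f \<Longrightarrow> 0 < \<epsilon> \<Longrightarrow> \<exists>s\<in>S. (LINT x|lebesgue. norm (f x - s x)) < \<epsilon>"
    and U: "open U"
  shows "aumann_integral t0 T H u t \<inter> U \<noteq> {} \<longleftrightarrow>
    (\<exists>s\<in>S. \<exists>\<epsilon>\<in>\<rat>. 0 < \<epsilon> \<and> ball (integral\<^sup>L (lebesgue_on {u..t}) s) \<epsilon> \<subseteq> U \<and>
      (\<integral>\<^sup>+\<tau>. ennreal (infdist (s \<tau>) (H \<tau>)) \<partial>lebesgue_on {u..t}) < ennreal \<epsilon>)"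
    (is "_ \<longleftrightarrow> (\<exists>s\<in>S. \<exists>\<epsilon>\<in>\<rat>. ?Q s \<epsilon>)")
proof
  let ?L = "lebesgue_on {u..t}" and ?K = "lebesgue_on {t0..T}"
  have sub: "{u..t} \<subseteq> {t0..T}" using ut by auto
  have restr: "integrable ?L g" if "integrable ?K g" for g :: "real \<Rightarrow> 'a"
  proof -
    have "set_integrable lebesgue {t0..T} g"
      using that by (simp add: set_integrable_def integrable_restrict_space)
    then have "set_integrable lebesgue {u..t} g" by (rule set_integrable_subset) (use sub in auto)
    then show ?thesis by (simp add: set_integrable_def integrable_restrict_space)
  qed
  have SL: "integrable ?L s" "integrable ?K s" if "s \<in> S" for s
    using S(1)[OF that] by (auto simp: integrable_restrict_space intro: integrable_mult_indicator)
  {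
    assume "aumann_integral t0 T H u t \<inter> U \<noteq> {}"
    then obtain g where g: "integrable ?K g" "AE \<tau> in ?K. g \<tau> \<in> H \<tau>" "integral\<^sup>L ?L g \<in> U"
      unfolding aumann_integral_def by auto
    obtain r where r: "0 < r" "ball (integral\<^sup>L ?L g) r \<subseteq> U" using U g(3) by (auto simp: open_contains_ball)
    \<comment> \<open>The integral of \<open>s\<close> will lie within \<open>\<epsilon>\<close> of
      that of \<open>g\<close>; since \<open>2 * \<epsilon> < r\<close>, its ball of radius
      \<open>\<epsilon>\<close> stays inside the ball of radius \<open>r\<close>.\<close>
    obtain \<epsilon> where \<epsilon>: "\<epsilon> \<in> \<rat>" "0 < \<epsilon>" "\<epsilon> < r / 2" using Rats_dense_in_real[of 0 "r / 2"] r by auto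
    \<comment> \<open>The extension of \<open>g\<close> by zero, since \<open>S\<close> is dense
      among the functions integrable on the whole line.\<close>
    define f where "f \<tau> = indicator {t0..T} \<tau> *\<^sub>R g \<tau>" for \<tau>
    have f: "integrable lebesgue f" using g(1) by (simp add: f_def[abs_def] integrable_restrict_space)
    obtain s where s: "s \<in> S" "(LINT x|lebesgue. norm (f x - s x)) < \<epsilon>" using S(2)[OF f \<epsilon>(2)] by blast
    have "(\<integral>\<^sup>+\<tau>. ennreal (norm (g \<tau> - s \<tau>)) \<partial>?L) =
        (\<integral>\<^sup>+\<tau>. ennreal (norm (g \<tau> - s \<tau>)) * indicator {u..t} \<tau> \<partial>lebesgue)"
      by (rule nn_integral_restrict_space) simp
    also have "\<dots> \<le> (\<integral>\<^sup>+\<tau>. ennreal (norm (f \<tau> - s \<tau>)) \<partial>lebesgue)"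
      by (rule nn_integral_mono) (use sub in \<open>auto simp: f_def indicator_def\<close>)
    also have "\<dots> = ennreal (LINT x|lebesgue. norm (f x - s x))"
      using f S(1)[OF s(1)] by (intro nn_integral_eq_integral) auto
    also have "\<dots> < ennreal \<epsilon>" using s(2) \<epsilon>(2) by (intro ennreal_lessI)
    finally have gs: "(\<integral>\<^sup>+\<tau>. ennreal (norm (g \<tau> - s \<tau>)) \<partial>?L) < ennreal \<epsilon>" .
    have "AE \<tau> in ?L. g \<tau> \<in> H \<tau>"
      using g(2) sub by (auto simp: AE_restrict_space_iff elim!: eventually_mono)
    then have "AE \<tau> in ?L. ennreal (infdist (s \<tau>) (H \<tau>)) \<le> ennreal (norm (g \<tau> - s \<tau>))"
      by eventually_elim (metis dist_norm ennreal_leI infdist_le norm_minus_commute)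
    then have "(\<integral>\<^sup>+\<tau>. ennreal (infdist (s \<tau>) (H \<tau>)) \<partial>?L) < ennreal \<epsilon>"
      by (rule le_less_trans[OF nn_integral_mono_AE gs])
    moreover have "dist (integral\<^sup>L ?L g) (integral\<^sup>L ?L s) < \<epsilon>"
    proof -
      have "ennreal (norm (integral\<^sup>L ?L (\<lambda>\<tau>. g \<tau> - s \<tau>))) \<le> (\<integral>\<^sup>+\<tau>. ennreal (norm (g \<tau> - s \<tau>)) \<partial>?L)"
        by (intro integral_norm_bound_ennreal Bochner_Integration.integrable_diff restr g SL s)
      then have "ennreal (norm (integral\<^sup>L ?L (\<lambda>\<tau>. g \<tau> - s \<tau>))) < ennreal \<epsilon>" using gs by simp
      then show ?thesis
        using \<epsilon>(2) restr[OF g(1)] SL[OF s(1)] by (simp add: ennreal_less_iff dist_norm)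
    qed
    then have "ball (integral\<^sup>L ?L s) \<epsilon> \<subseteq> U"
      using \<epsilon>(3) r(2) by (smt (verit) dist_commute dist_triangle mem_ball subset_iff field_sum_of_halves)
    ultimately show "\<exists>s\<in>S. \<exists>\<epsilon>\<in>\<rat>. ?Q s \<epsilon>" using s(1) \<epsilon> by blast
  }
  {
    assume "\<exists>s\<in>S. \<exists>\<epsilon>\<in>\<rat>. ?Q s \<epsilon>"
    then obtain s \<epsilon> where s: "s \<in> S" and \<epsilon>: "0 < \<epsilon>" "ball (integral\<^sup>L ?L s) \<epsilon> \<subseteq> U"
      and less: "(\<integral>\<^sup>+\<tau>. ennreal (infdist (s \<tau>) (H \<tau>)) \<partial>?L) < ennreal \<epsilon>" by blast
    then obtain i where i: "0 \<le> i" "(\<integral>\<^sup>+\<tau>. ennreal (infdist (s \<tau>) (H \<tau>)) \<partial>?L) = ennreal i"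
      by (cases "\<integral>\<^sup>+\<tau>. ennreal (infdist (s \<tau>) (H \<tau>)) \<partial>?L") auto
    then have "i < \<epsilon>" using less \<epsilon>(1) by (simp add: ennreal_less_iff)
    \<comment> \<open>The slack \<open>\<epsilon> - i\<close> is spread over the interval; the added
      one covers \<open>u = t\<close> and keeps the estimate strict.\<close>
    define \<delta> where "\<delta> = (\<epsilon> - i) / (t - u + 1)"
    have \<delta>: "0 < \<delta>" "i + \<delta> * (t - u) < \<epsilon>"
      using \<open>i < \<epsilon>\<close> ut by (auto simp: \<delta>_def field_simps)
    have sm: "s \<in> borel_measurable ?K" using SL(2)[OF s] by simp
    \<comment> \<open>The selection is made on all of \<open>{t0..T}\<close>, as the Aumann integral
      demands, although only its values on \<open>{u..t}\<close> enter the integral.\<close>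
    obtain g where g: "g \<in> borel_measurable ?K"
      "\<And>\<tau>. \<tau> \<in> {t0..T} \<Longrightarrow> g \<tau> \<in> H \<tau> \<and> dist (s \<tau>) (g \<tau>) \<le> infdist (s \<tau>) (H \<tau>) + \<delta>"
      using near_measurable_selection[OF meas _ _ sm \<delta>(1)] cl ne by (auto simp: space_restrict_space)
    interpret K: finite_measure ?K
      by (rule finite_measure_lebesgue_on) auto
    have gi: "integrable ?K g"
      by (rule K.integrable_const_bound[where B = R]) (use g R in \<open>auto simp: space_restrict_space intro!: AE_I2\<close>)
    have mi: "(\<lambda>\<tau>. infdist (s \<tau>) (H \<tau>)) \<in> borel_measurable ?L"
    proof (rule borel_measurable_infdist_set_map)
      have "(\<lambda>\<tau>. \<tau>) \<in> measurable ?L ?K"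
        by (intro measurable_restrict_space2 measurable_restrict_space1)
          (use sub[THEN subsetD] in \<open>simp_all add: space_restrict_space Pi_def\<close>)
      from measurable_set_map_compose[OF meas this] show "measurable_set_map ?L H" .
    qed (use ne sub SL(1)[OF s] in \<open>auto simp: space_restrict_space\<close>)
    have "ennreal (norm (integral\<^sup>L ?L (\<lambda>\<tau>. s \<tau> - g \<tau>))) \<le> (\<integral>\<^sup>+\<tau>. ennreal (norm (s \<tau> - g \<tau>)) \<partial>?L)"
      by (intro integral_norm_bound_ennreal Bochner_Integration.integrable_diff restr gi SL s)
    also have "\<dots> \<le> (\<integral>\<^sup>+\<tau>. ennreal (infdist (s \<tau>) (H \<tau>)) + ennreal \<delta> \<partial>?L)"
      by (rule nn_integral_mono)
        (use g(2) sub \<delta> in \<open>auto simp: space_restrict_space dist_norm infdist_nonneg simp flip: ennreal_plus intro!: ennreal_leI\<close>)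
    also have "\<dots> = ennreal i + ennreal \<delta> * emeasure ?L (space ?L)"
      using mi i by (subst nn_integral_add) auto
    also have "emeasure ?L (space ?L) = ennreal (t - u)"
      using ut by (simp add: emeasure_restrict_space space_restrict_space)
    also have "ennreal i + ennreal \<delta> * ennreal (t - u) = ennreal (i + \<delta> * (t - u))"
      using i \<delta> ut by (simp add: ennreal_mult ennreal_plus)
    also have "\<dots> < ennreal \<epsilon>" using \<delta> \<epsilon> by (intro ennreal_lessI)
    finally have "norm (integral\<^sup>L ?L (\<lambda>\<tau>. s \<tau> - g \<tau>)) < \<epsilon>" using \<epsilon> by (simp add: ennreal_less_iff)
    then have "integral\<^sup>L ?L g \<in> U"
      using \<epsilon>(2) restr[OF gi] SL[OF s] by (auto simp: dist_norm)
    moreover have "integral\<^sup>L ?L g \<in> aumann_integral t0 T H u t"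
      unfolding aumann_integral_def using gi g(2)
      by (intro CollectI exI[of _ g]) (auto intro!: AE_I2 simp: space_restrict_space)
    ultimately show "aumann_integral t0 T H u t \<inter> U \<noteq> {}" by blast
  }
qed

section \<open>From predictability to adaptedness of the Aumann integral\<close>

context filtered_complete_prob_space
begin

lemma space_F: "t \<in> {t0..T} \<Longrightarrow> space (F t) = space M"
  using subalgebra_F by (simp add: subalgebra_def)

text \<open>A generator \<open>A \<times> {s<..r}\<close> with \<open>s \<le> t\<close> has as its
  trace on times up to \<open>t\<close> a rectangle over \<open>A\<close>, which lies in
  \<open>F s\<close> and hence in \<open>F t\<close>; if \<open>t < s\<close> the trace is empty.
  Predictable maps are therefore progressively measurable.\<close>

lemma measurable_ident_predictable:
  assumes ut: "t0 \<le> u" "u \<le> t" "t \<le> T"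
  shows "(\<lambda>x. x) \<in> measurable (F t \<Otimes>\<^sub>M lebesgue_on {u..t}) (predictable_sigma M F t0 T)"
  unfolding predictable_sigma_def
proof (rule measurable_measure_of)
  have sub: "A \<subseteq> space M" if "A \<in> sets (F s)" "s \<in> {t0..T}" for A s
    using sets.sets_into_space[OF that(1)] space_F[OF that(2)] by simp
  show "{A \<times> {t0} |A. A \<in> sets (F t0)} \<union>
      {A \<times> {s<..r} |A s r. t0 \<le> s \<and> s < r \<and> r \<le> T \<and> A \<in> sets (F s)} \<subseteq> Pow (space M \<times> {t0..T})"
  proof -
    have "A \<times> {s<..r} \<subseteq> space M \<times> {t0..T}" if "t0 \<le> s" "s < r" "r \<le> T" "A \<in> sets (F s)" for A s r
      using sub[OF that(4)] that by auto
    moreover have "A \<times> {t0} \<subseteq> space M \<times> {t0..T}" if "A \<in> sets (F t0)" for A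
      using sub[OF that] interval by auto
    ultimately show ?thesis by blast
  qed
  show "(\<lambda>x. x) \<in> space (F t \<Otimes>\<^sub>M lebesgue_on {u..t}) \<rightarrow> space M \<times> {t0..T}"
    using ut by (auto simp: space_pair_measure space_restrict_space space_F)
  fix E assume "E \<in> {A \<times> {t0} |A. A \<in> sets (F t0)} \<union>
      {A \<times> {s<..r} |A s r. t0 \<le> s \<and> s < r \<and> r \<le> T \<and> A \<in> sets (F s)}"
  then consider A where "E = A \<times> {t0}" "A \<in> sets (F t0)"
    | A s r where "E = A \<times> {s<..r}" "t0 \<le> s" "s < r" "r \<le> T" "A \<in> sets (F s)" by blast
  then show "(\<lambda>x. x) -` E \<inter> space (F t \<Otimes>\<^sub>M lebesgue_on {u..t}) \<in> sets (F t \<Otimes>\<^sub>M lebesgue_on {u..t})"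
  proof cases
    case 1
    have A: "A \<in> sets (F t)" using sets_F_mono[of t0 t] 1 ut by auto
    have "(\<lambda>x. x) -` E \<inter> space (F t \<Otimes>\<^sub>M lebesgue_on {u..t}) = A \<times> ({t0} \<inter> {u..t})"
      using sets.sets_into_space[OF A] by (auto simp: 1 space_pair_measure space_restrict_space)
    moreover have "{t0} \<inter> {u..t} \<in> sets (lebesgue_on {u..t})"
      by (auto simp: sets_restrict_space intro!: image_eqI[where x = "{t0}"])
    ultimately show ?thesis using A by auto
  next
    case 2
    show ?thesis
    proof (cases "s \<le> t")
      case True
      have A: "A \<in> sets (F t)" using sets_F_mono[of s t] 2 True ut by auto
      have "(\<lambda>x. x) -` E \<inter> space (F t \<Otimes>\<^sub>M lebesgue_on {u..t}) = A \<times> ({s<..r} \<inter> {u..t})"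
        using sets.sets_into_space[OF A] by (auto simp: 2 space_pair_measure space_restrict_space)
      moreover have "{s<..r} \<inter> {u..t} \<in> sets (lebesgue_on {u..t})"
        by (auto simp: sets_restrict_space intro!: image_eqI[where x = "{s<..r}"])
      ultimately show ?thesis using A by auto
    next
      case False
      then have "(\<lambda>x. x) -` E \<inter> space (F t \<Otimes>\<^sub>M lebesgue_on {u..t}) = {}"
        by (auto simp: 2 space_pair_measure space_restrict_space)
      then show ?thesis by simp
    qed
  qed
qed

text \<open>In the criterion for hitting \<open>U\<close>, only the integral of the distance depends
  on \<open>\<omega>\<close>. Tonelli makes it \<open>F t\<close>-measurable, and countably many
  pairs \<open>(s, \<epsilon>)\<close> suffice.\<close>

lemma measurable_set_map_aumann_integral:
  fixes G :: "'w \<Rightarrow> real \<Rightarrow> 'a::{banach, second_countable_topology} set"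
  assumes G: "growth_process M F t0 T G" and ut: "t0 \<le> u" "u \<le> t" "t \<le> T"
  shows "measurable_set_map (F t) (\<lambda>\<omega>. aumann_integral t0 T (G \<omega>) u t)"
  unfolding measurable_set_map_def
proof (intro allI impI)
  fix U :: "'a set" assume U: "open U"
  let ?L = "lebesgue_on {u..t}"
  have tT: "t \<in> {t0..T}" "T \<in> {t0..T}" using ut interval by auto
  have cl: "closed (G \<omega> \<tau>)" "0 \<in> G \<omega> \<tau>" if "\<omega> \<in> space M" "\<tau> \<in> {t0..T}" for \<omega> \<tau>
    using G that by (auto simp: growth_process_def)
  obtain K where "bounded K" and GK: "\<And>\<omega> t. \<omega> \<in> space M \<Longrightarrow> t \<in> {t0..T} \<Longrightarrow> G \<omega> t \<subseteq> K"
    using G unfolding growth_process_def by blast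
  then obtain R where R: "\<And>y. y \<in> K \<Longrightarrow> norm y \<le> R" unfolding bounded_iff by blast
  have Gm: "measurable_set_map (F r \<Otimes>\<^sub>M lebesgue_on {v..r}) (\<lambda>(\<omega>, \<tau>). G \<omega> \<tau>)"
    if "t0 \<le> v" "v \<le> r" "r \<le> T" for v r
    by (rule measurable_set_map_compose[OF _ measurable_ident_predictable[OF that]])
      (use G in \<open>simp add: growth_process_def\<close>)
  \<comment> \<open>The criterion needs the section over the whole of \<open>{t0..T}\<close>. Using
    the larger \<open>F T\<close> does no harm here, because \<open>\<omega>\<close> is
    fixed.\<close>
  have sec: "measurable_set_map (lebesgue_on {t0..T}) (G \<omega>)" if \<omega>: "\<omega> \<in> space M" for \<omega>
  proof -
    have "Pair \<omega> \<in> measurable (lebesgue_on {t0..T}) (F T \<Otimes>\<^sub>M lebesgue_on {t0..T})"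
      by (rule measurable_Pair1') (simp add: \<omega> space_F[OF tT(2)])
    from measurable_set_map_compose[OF Gm[OF order_refl interval order_refl] this]
    show ?thesis by simp
  qed
  obtain S :: "(real \<Rightarrow> 'a) set" where S: "countable S" "\<And>s. s \<in> S \<Longrightarrow> integrable lebesgue s"
    "\<And>f \<epsilon>. integrable lebesgue f \<Longrightarrow> 0 < \<epsilon> \<Longrightarrow> \<exists>s\<in>S. (LINT x|lebesgue. norm (f x - s x)) < \<epsilon>"
    using countable_L1_dense by blast
  \<comment> \<open>The ball condition does not involve \<open>\<omega>\<close>, so it can be moved
    into the index set.\<close>
  define I where "I = {(s, \<epsilon>) \<in> S \<times> \<rat>. 0 < \<epsilon> \<and> ball (integral\<^sup>L ?L s) \<epsilon> \<subseteq> U}"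
  have "countable I"
    by (rule countable_subset[of _ "S \<times> \<rat>"]) (use S(1) in \<open>auto simp: I_def countable_rat\<close>)
  have hit: "aumann_integral t0 T (G \<omega>) u t \<inter> U \<noteq> {} \<longleftrightarrow>
      (\<exists>(s, \<epsilon>)\<in>I. (\<integral>\<^sup>+\<tau>. ennreal (infdist (s \<tau>) (G \<omega> \<tau>)) \<partial>?L) < ennreal \<epsilon>)" if \<omega>: "\<omega> \<in> space M" for \<omega>
  proof (subst aumann_integral_hits_iff[OF ut sec[OF \<omega>] _ _ _ S(2,3) U, where R = R])
    show "G \<omega> \<tau> \<noteq> {}" if "\<tau> \<in> {t0..T}" for \<tau> using cl(2)[OF \<omega> that] by blast
    show "norm y \<le> R" if "\<tau> \<in> {t0..T}" "y \<in> G \<omega> \<tau>" for \<tau> y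
      using R GK[OF \<omega> that(1)] that(2) by blast
  qed (use \<omega> cl in \<open>auto simp: I_def\<close>)
  have "{\<omega> \<in> space (F t). (\<integral>\<^sup>+\<tau>. ennreal (infdist (s \<tau>) (G \<omega> \<tau>)) \<partial>?L) < ennreal \<epsilon>} \<in> sets (F t)"
    if s: "s \<in> S" for s \<epsilon>
  proof -
    interpret L: finite_measure ?L
      by (rule finite_measure_lebesgue_on) auto
    have "integrable ?L s"
      using S(2)[OF s] by (auto simp: integrable_restrict_space intro: integrable_mult_indicator)
    then have s_meas: "s \<in> borel_measurable ?L" by simp
    have "(\<lambda>x. s (snd x)) \<in> borel_measurable (F t \<Otimes>\<^sub>M ?L)"
      by (rule measurable_compose[OF measurable_snd s_meas])
    \<comment> \<open>Non-empty values are required because \<open>infdist\<close> to the empty set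
      is zero by convention.\<close>
    moreover have "(\<lambda>(\<omega>, \<tau>). G \<omega> \<tau>) x \<noteq> {}" if "x \<in> space (F t \<Otimes>\<^sub>M ?L)" for x
    proof -
      have "x \<in> space M \<times> {u..t}"
        using that by (simp add: space_pair_measure space_restrict_space space_F[OF tT(1)])
      then have "0 \<in> G (fst x) (snd x)" using ut by (intro cl(2)) auto
      then show ?thesis by (auto simp: split_beta)
    qed
    ultimately have "(\<lambda>x. infdist (s (snd x)) ((\<lambda>(\<omega>, \<tau>). G \<omega> \<tau>) x)) \<in> borel_measurable (F t \<Otimes>\<^sub>M ?L)"
      by (intro borel_measurable_infdist_set_map[OF Gm[OF ut]])
    then have meas: "(\<lambda>(\<omega>, \<tau>). ennreal (infdist (s \<tau>) (G \<omega> \<tau>))) \<in> borel_measurable (F t \<Otimes>\<^sub>M ?L)"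
      by (simp add: split_beta')
    show ?thesis
      by (rule borel_measurable_less[OF L.borel_measurable_nn_integral[OF meas] borel_measurable_const])
  qed
  then have "(\<Union>(s, \<epsilon>)\<in>I. {\<omega> \<in> space (F t). (\<integral>\<^sup>+\<tau>. ennreal (infdist (s \<tau>) (G \<omega> \<tau>)) \<partial>?L) < ennreal \<epsilon>}) \<in> sets (F t)"
    using \<open>countable I\<close> by (intro sets.countable_UN') (auto simp: I_def)
  moreover have "{\<omega> \<in> space (F t). aumann_integral t0 T (G \<omega>) u t \<inter> U \<noteq> {}} =
      (\<Union>(s, \<epsilon>)\<in>I. {\<omega> \<in> space (F t). (\<integral>\<^sup>+\<tau>. ennreal (infdist (s \<tau>) (G \<omega> \<tau>)) \<partial>?L) < ennreal \<epsilon>})"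
  proof (rule set_eqI)
    fix \<omega>
    show "\<omega> \<in> {\<omega> \<in> space (F t). aumann_integral t0 T (G \<omega>) u t \<inter> U \<noteq> {}} \<longleftrightarrow>
        \<omega> \<in> (\<Union>(s, \<epsilon>)\<in>I. {\<omega> \<in> space (F t). (\<integral>\<^sup>+\<tau>. ennreal (infdist (s \<tau>) (G \<omega> \<tau>)) \<partial>?L) < ennreal \<epsilon>})"
      using hit[of \<omega>] by (cases "\<omega> \<in> space M") (simp_all add: space_F[OF tT(1)] split_beta')
  qed
  ultimately show "{\<omega> \<in> space (F t). aumann_integral t0 T (G \<omega>) u t \<inter> U \<noteq> {}} \<in> sets (F t)"
    by simp
qed

end

section \<open>Monotonicity and adaptedness of the geometric process\<close>

theorem theorem4p9:
  fixes M :: "'w measure" and F :: "real \<Rightarrow> 'w measure" and t0 T :: real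
    and B G \<Theta> :: "'w \<Rightarrow> real \<Rightarrow> 'a::{banach, second_countable_topology} set"
  assumes "reflexive_banach TYPE('a)" and "separable_dual TYPE('a)"
    and "filtered_complete_prob_space M F t0 T"
    and "nucleation_process M F t0 T B"
    and "growth_process M F t0 T G"
    and "geometric_random_process M t0 T B G \<Theta>"
  shows "measure M {\<omega> \<in> space M. \<forall>s t. t0 \<le> s \<and> s < t \<and> t \<le> T \<longrightarrow> \<Theta> \<omega> s \<subseteq> \<Theta> \<omega> t} = 1 \<and>
    (\<forall>t\<in>{t0..T}. random_closed_set (F t) (\<lambda>\<omega>. \<Theta> \<omega> t))"
proof -
  interpret filtered_complete_prob_space M F t0 T by fact
  have G0: "0 \<in> G \<omega> \<tau>" if "\<omega> \<in> space M" "\<tau> \<in> {t0..T}" for \<omega> \<tau>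
    using assms(5) that by (auto simp: growth_process_def)
  have Bmono: "B \<omega> u \<subseteq> B \<omega> v" if "\<omega> \<in> space M" "t0 \<le> u" "u \<le> v" "v \<le> T" for \<omega> u v
    using assms(4) that unfolding nucleation_process_def by (cases "u = v") auto
  have \<Theta>: "geometric_value t0 T (B \<omega>) (G \<omega>) t (\<Theta> \<omega> t)" if "\<omega> \<in> space M" "t \<in> {t0..T}" for \<omega> t
    using assms(6) that by (simp add: geometric_random_process_def)
  have "\<Theta> \<omega> s \<subseteq> \<Theta> \<omega> t" if "\<omega> \<in> space M" "t0 \<le> s" "s < t" "t \<le> T" for \<omega> s t
    by (rule geometric_value_mono[of t0 s t T "G \<omega>" "B \<omega>"]) (use that G0 Bmono \<Theta> in auto)
  \<comment> \<open>The inclusions hold for every \<open>\<omega>\<close>, so the event is the whole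
    space and its measurability is no issue despite the uncountably many pairs of times.\<close>
  then have "{\<omega> \<in> space M. \<forall>s t. t0 \<le> s \<and> s < t \<and> t \<le> T \<longrightarrow> \<Theta> \<omega> s \<subseteq> \<Theta> \<omega> t} = space M" by blast
  then have "measure M {\<omega> \<in> space M. \<forall>s t. t0 \<le> s \<and> s < t \<and> t \<le> T \<longrightarrow> \<Theta> \<omega> s \<subseteq> \<Theta> \<omega> t} = 1"
    by (simp add: prob_space)
  moreover
  have "random_closed_set (F t) (\<lambda>\<omega>. \<Theta> \<omega> t)" if t: "t \<in> {t0..T}" for t
  proof -
    have t': "t0 \<le> t" "t \<le> T" using t by auto
    obtain P where P: "refinement_sequence t0 t P" using refinement_sequence_exists[OF t'(1)] ..
    \<comment> \<open>The same partitions serve every \<open>\<omega>\<close>, so \<open>?Q\<close>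
      is a countable set of deterministic times.\<close>
    let ?Q = "\<Union>j. set (P j)" and ?V = "\<lambda>u \<omega>. B \<omega> u + aumann_integral t0 T (G \<omega>) u t"
    have Q: "t0 \<le> u" "u \<le> t" if "u \<in> ?Q" for u
      using that refinement_sequence_mem[OF P] by auto
    have eq: "\<Theta> \<omega> t = closure (\<Union>u\<in>?Q. ?V u \<omega>)" if \<omega>: "\<omega> \<in> space M" for \<omega>
      by (rule geometric_value_eq_closure[OF t'(2)])
        (use \<omega> t P G0 Bmono \<Theta> in auto)
    have "measurable_set_map (F t) (\<lambda>\<omega>. closure (\<Union>u\<in>?Q. ?V u \<omega>))"
    proof (intro measurable_set_map_closure measurable_set_map_UN measurable_set_map_plus)
      fix u assume u: "u \<in> ?Q"
      then have u': "u \<in> {t0..T}" using Q t' by force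
      show "measurable_set_map (F t) (\<lambda>\<omega>. aumann_integral t0 T (G \<omega>) u t)"
        by (rule measurable_set_map_aumann_integral[OF assms(5)]) (use Q u t in auto)
      have "measurable_set_map (F u) (\<lambda>\<omega>. B \<omega> u)"
        using assms(4) u' by (auto simp: nucleation_process_def random_closed_set_def)
      then show "measurable_set_map (F t) (\<lambda>\<omega>. B \<omega> u)"
        by (rule measurable_set_map_subalgebra)
          (use sets_F_mono[OF u' t] Q[OF u] space_F u' t in auto)
    qed (auto intro: countable_finite)
    then have "measurable_set_map (F t) (\<lambda>\<omega>. \<Theta> \<omega> t)"
      by (simp add: measurable_set_map_def space_F[OF t] eq cong: conj_cong)
    \<comment> \<open>The initial set \<open>B \<omega> t0\<close> is non-empty and zero is a
      possible growth, so their sum supplies a point.\<close>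
    moreover have "\<Theta> \<omega> t \<noteq> {}" if \<omega>: "\<omega> \<in> space M" for \<omega>
    proof -
      have "B \<omega> t0 \<noteq> {}"
        using assms(4) \<omega> interval space_F[of t0] by (auto simp: nucleation_process_def random_closed_set_def)
      moreover have "0 \<in> aumann_integral t0 T (G \<omega>) t0 t"
        by (rule aumann_integral_zero) (rule G0[OF \<omega>])
      ultimately have "?V t0 \<omega> \<noteq> {}" by (metis empty_iff equals0I set_plus_intro)
      moreover have "?V t0 \<omega> \<subseteq> \<Theta> \<omega> t"
        by (rule set_plus_subset_geometric_value[OF t'(2)])
         (use \<omega> t G0 Bmono \<Theta> in auto)
      ultimately show ?thesis by blast
    qed
    ultimately show "random_closed_set (F t) (\<lambda>\<omega>. \<Theta> \<omega> t)"
      by (auto simp: random_closed_set_def space_F[OF t] eq)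
  qed
  ultimately show ?thesis by blast
qed

end
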